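(* Let $X$ be a downward skip-free continuous-time Markov chain on $\mathbb{N}$ satisfying the standing assumptions of the context, with $Q$-matrix $Q$ and $q$-scale functions $W^{(q)}$ ($q\ge 0$), regarded as matrices $W^{(q)}=(W^{(q)}(x,y))_{x,y\ge 0}$, and let $W:=W^{(0)}$. Then: (1) For every $q\ge 0$, the matrix $F=W^{(q)}$ is the unique triangular matrix solution of $$QF(x,y)=I(x,y)+qF(x,y)\qquad (x\ge 1,\ y\ge 0).$$ (2) For every $q \ge 0$ it has the polynomial representation $$W^{(q)}(x,y)=\sum_{n\ge 0}q^{n}W^{n+1}(x,y)=\sum_{0\le n\le y-x-1}q^{n}W^{n+1}(x,y)\qquad (x,y\ge 0),$$ where $W^{n}$ is the $n$-th matrix power of $W$. Hence $q\mapsto W^{(q)}(x,y)$ extends to an entire function of $q\in\mathbb{C}$ (a polynomial), still denoted $W^{(q)}(x,y)$. (3) For every $q\in\mathbb{C}$, the matrix $I-qW$ is invertible and $$W^{(q)}=(I-qW)^{-1}W=W(I-qW)^{-1}.$$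
   Context: $\mathbb{N}=\{0,1,2,\dots\}$. $(\{X_t\}_{t\ge0},\{\mathbb{P}_x\}_{x\in\mathbb{N}})$ is a continuous-time Markov chain on $\mathbb{N}$ with càdlàg paths, whose $Q$-matrix $Q=(Q(x,y))_{x,y\ge0}$ is conservative ($\sum_{y}Q(x,y)=0$ for all $x$), killed at its explosion time $\lim_{z\to\infty}\tau_z^+$. For $A\subset\mathbb{N}$, $\tau_A:=\inf\{t>0: X_t\in A\}$ (with $\inf\emptyset=\infty$), $\tau_x:=\tau_{\{x\}}$, $\tau_z^+:=\tau_{[z,\infty)\cap\mathbb{N}}$; $Q(x):=-Q(x,x)$. $\mathbb{E}_x[Y,A]$ means $\mathbb{E}_x[Y1_A]$. Standing assumptions: $X$ is downward skip-free, i.e. $Q(x,y)=0$ for $0\le y\le x-2$; $X$ is irreducible on $\mathbb{N}\setminus\{0\}$: $\mathbb{P}_x[\tau_y<\infty]>0$ for $x\ge1$, $y\ge0$; $X$ is regular on $\mathbb{N}\setminus\{0\}$: $\mathbb{P}_x[\tau_{\mathbb{N}\setminus\{x\}}>0]=1$ for $x\ge1$; and $0$ is a trap: $\mathbb{P}_0[X_t=0]=1$ for all $t$ (i.e. $Q(0,x)=0$ for all $x$). Then $Q(x)\in(0,\infty)$ for $x\ge1$. Excursion measure and scale function: for $z\ge1$, $n_z$ is $Q(z)$ times the law under $\mathbb{P}_z$ of the path of $X$ after its first exit time from $z$, stopped upon returning to $z$. Thus, writing $\sigma_z:=\tau_{\mathbb{N}\setminus\{z\}}$ and $R_z:=\inf\{t>\sigma_z:X_t=z\}$,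 for $x<z$, $n_z[e^{-q\tau_x},\tau_x<\infty]=Q(z)\,\mathbb{E}_z[e^{-q(\tau_x-\sigma_z)},\ \tau_x<R_z]$. For $q\ge0$ the $q$-scale function is $W^{(q)}(x,z):=1/n_z[e^{-q\tau_x},\tau_x<\infty]$ for $0\le x<z$ and $W^{(q)}(x,z):=0$ for $x\ge z$. A matrix $M=(M(x,y))_{x,y\in\mathbb{N}}$ is called triangular if $M(x,y)=0$ for all $x\ge y$. $I=(\delta_{xy})_{x,y\ge0}$. All matrix products are the usual ones, $AB(x,y)=\sum_u A(x,u)B(u,y)$ (finite sums here); invertibility and inverses are understood in the algebra of matrices with $M(x,y)=0$ for $x>y$. *)

theory Defs
  imports "HOL-Probability.Probability"
begin

section \<open>Paths killed at explosion\<close>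

text \<open>A path is a function of time with values in \<^typ>\<open>nat option\<close>; \<^term>\<open>None\<close> is the cemetery,
  which belongs to no set of states.  Only times \<open>t \<ge> 0\<close> are relevant.\<close>

type_synonym path = "real \<Rightarrow> nat option"

definition hit_time :: "nat set \<Rightarrow> path \<Rightarrow> ereal" where
  "hit_time A p = Inf {ereal t | t. 0 < t \<and> p t \<in> Some ` A}"

definition exit_time :: "nat \<Rightarrow> path \<Rightarrow> ereal" where
  "exit_time z p = hit_time (- {z}) p"

definition return_time :: "nat \<Rightarrow> path \<Rightarrow> ereal" where
  "return_time z p = Inf {ereal t | t. exit_time z p < ereal t \<and> p t = Some z}"

text \<open>The first passage times above \<open>z\<close> are nondecreasing in \<open>z\<close>, so their limit is the supremum.\<close>

definition explosion_time :: "path \<Rightarrow> ereal" where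
  "explosion_time p = (SUP z. hit_time {z..} p)"

text \<open>The state space is discrete, so convergence means being eventually constant.  Left limits
  are required in the state space only strictly before the explosion time; the path is dead
  exactly from the explosion time on.\<close>

definition cadlag_killed :: "path \<Rightarrow> bool" where
  "cadlag_killed p \<longleftrightarrow>
     (\<forall>t\<ge>0. p t = None \<longleftrightarrow> explosion_time p \<le> ereal t) \<and>
     (\<forall>t\<ge>0. ereal t < explosion_time p \<longrightarrow> (\<forall>\<^sub>F s in at_right t. p s = p t)) \<and>
     (\<forall>t>0. ereal t < explosion_time p \<longrightarrow> (\<exists>y. \<forall>\<^sub>F s in at_left t. p s = Some y))"

section \<open>Continuous-time Markov chains with a given Q-matrix\<close>

definition past :: "'a measure \<Rightarrow> ('a \<Rightarrow> path) \<Rightarrow> real \<Rightarrow> 'a set set" where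
  "past M X t =
     sigma_sets (space M) {{\<omega> \<in> space M. X \<omega> u \<in> B} | u B. 0 \<le> u \<and> u \<le> t}"

text \<open>The assumption \<open>markov\<close> is the Markov property
  \<open>P\<^sub>x[X(t+s) = z | F(t)] = P\<^bsub>X(t)\<^esub>[X(s) = z]\<close> with respect to the natural filtration, integrated
  over the events \<open>A \<inter> {X(t) = y}\<close> with \<open>A\<close> in \<open>F(t)\<close>.\<close>

locale markov_chain =
  fixes M :: "'a measure"
    and P :: "nat \<Rightarrow> 'a measure"
    and X :: "'a \<Rightarrow> path"
    and Q :: "nat \<Rightarrow> nat \<Rightarrow> real"
  assumes prob: "\<And>x. prob_space (P x)"
    and sets_P: "\<And>x. sets (P x) = sets M"
    and meas: "\<And>t. 0 \<le> t \<Longrightarrow> (\<lambda>\<omega>. X \<omega> t) \<in> measurable M (count_space UNIV)"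
    and paths: "\<And>\<omega>. \<omega> \<in> space M \<Longrightarrow> cadlag_killed (X \<omega>)"
    and start: "\<And>x. measure (P x) {\<omega> \<in> space M. X \<omega> 0 = Some x} = 1"
    and markov: "\<And>x y z s t A. 0 \<le> s \<Longrightarrow> 0 \<le> t \<Longrightarrow> A \<in> past M X t \<Longrightarrow>
        measure (P x) (A \<inter> {\<omega> \<in> space M. X \<omega> t = Some y \<and> X \<omega> (t + s) = Some z}) =
        measure (P x) (A \<inter> {\<omega> \<in> space M. X \<omega> t = Some y}) *
        measure (P y) {\<omega> \<in> space M. X \<omega> s = Some z}"
    and Q_matrix: "\<And>x y.
        ((\<lambda>t. (measure (P x) {\<omega> \<in> space M. X \<omega> t = Some y} - (if x = y then 1 else 0)) / t)
          \<longlongrightarrow> Q x y) (at_right 0)"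
    and conservative: "\<And>x. (Q x) sums 0"

locale skip_free_chain = markov_chain +
  assumes skip_free: "\<And>x y. y + 2 \<le> x \<Longrightarrow> Q x y = 0"
    and irreducible: "\<And>x y. 1 \<le> x \<Longrightarrow>
        measure (P x) {\<omega> \<in> space M. hit_time {y} (X \<omega>) < \<infinity>} > 0"
    and regular: "\<And>x. 1 \<le> x \<Longrightarrow>
        measure (P x) {\<omega> \<in> space M. hit_time (- {x}) (X \<omega>) > 0} = 1"
    and trap: "\<And>t. 0 \<le> t \<Longrightarrow> measure (P 0) {\<omega> \<in> space M. X \<omega> t = Some 0} = 1"

section \<open>Scale functions\<close>

text \<open>\<open>n\<^sub>z[exp(- q \<tau>\<^sub>x), \<tau>\<^sub>x < \<infinity>]\<close>, for \<open>x < z\<close>, where \<open>n\<^sub>z\<close> is the excursion measure away from \<open>z\<close>.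
  On the event in question both times are finite, so \<^const>\<open>real_of_ereal\<close> loses nothing.\<close>

definition excursion_laplace ::
    "(nat \<Rightarrow> 'a measure) \<Rightarrow> ('a \<Rightarrow> path) \<Rightarrow> (nat \<Rightarrow> nat \<Rightarrow> real) \<Rightarrow> real \<Rightarrow> nat \<Rightarrow> nat \<Rightarrow> real" where
  "excursion_laplace P X Q q x z =
     (- Q z z) *
     (\<integral>\<omega>. exp (- q * real_of_ereal (hit_time {x} (X \<omega>) - exit_time z (X \<omega>))) *
          indicator {\<omega>. hit_time {x} (X \<omega>) < return_time z (X \<omega>)} \<omega> \<partial>P z)"

definition scale_fn ::
    "(nat \<Rightarrow> 'a measure) \<Rightarrow> ('a \<Rightarrow> path) \<Rightarrow> (nat \<Rightarrow> nat \<Rightarrow> real) \<Rightarrow> real \<Rightarrow> nat \<Rightarrow> nat \<Rightarrow> real" where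
  "scale_fn P X Q q x z = (if x < z then 1 / excursion_laplace P X Q q x z else 0)"

text \<open>\<open>V q x y\<close> is, entrywise, an entire extension of \<open>W q x y\<close> from \<open>q \<ge> 0\<close> to complex \<open>q\<close>.\<close>

definition entire_extension ::
    "(real \<Rightarrow> nat \<Rightarrow> nat \<Rightarrow> real) \<Rightarrow> (complex \<Rightarrow> nat \<Rightarrow> nat \<Rightarrow> complex) \<Rightarrow> bool" where
  "entire_extension W V \<longleftrightarrow>
     (\<forall>x y. (\<lambda>q. V q x y) holomorphic_on UNIV \<and>
            (\<forall>q\<ge>0. V (complex_of_real q) x y = complex_of_real (W q x y)))"

section \<open>Matrices indexed by the natural numbers\<close>

definition triangular :: "(nat \<Rightarrow> nat \<Rightarrow> 'b::zero) \<Rightarrow> bool" where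
  "triangular A \<longleftrightarrow> (\<forall>x y. y \<le> x \<longrightarrow> A x y = 0)"

definition upper_mat :: "(nat \<Rightarrow> nat \<Rightarrow> 'b::zero) \<Rightarrow> bool" where
  "upper_mat A \<longleftrightarrow> (\<forall>x y. y < x \<longrightarrow> A x y = 0)"

definition id_mat :: "nat \<Rightarrow> nat \<Rightarrow> 'b::zero_neq_one" where
  "id_mat x y = (if x = y then 1 else 0)"

definition mat_prod ::
    "(nat \<Rightarrow> nat \<Rightarrow> 'b) \<Rightarrow> (nat \<Rightarrow> nat \<Rightarrow> 'b) \<Rightarrow> nat \<Rightarrow> nat \<Rightarrow> 'b::real_normed_field" where
  "mat_prod A B x y = (\<Sum>u. A x u * B u y)"

primrec mat_pow :: "(nat \<Rightarrow> nat \<Rightarrow> 'b) \<Rightarrow> nat \<Rightarrow> nat \<Rightarrow> nat \<Rightarrow> 'b::real_normed_field" where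
  "mat_pow A 0 = id_mat"
| "mat_pow A (Suc n) = mat_prod (mat_pow A n) A"

definition is_upper_inverse ::
    "(nat \<Rightarrow> nat \<Rightarrow> 'b) \<Rightarrow> (nat \<Rightarrow> nat \<Rightarrow> 'b::real_normed_field) \<Rightarrow> bool" where
  "is_upper_inverse A B \<longleftrightarrow> upper_mat B \<and> mat_prod A B = id_mat \<and> mat_prod B A = id_mat"

definition upper_invertible :: "(nat \<Rightarrow> nat \<Rightarrow> 'b::real_normed_field) \<Rightarrow> bool" where
  "upper_invertible A \<longleftrightarrow> upper_mat A \<and> (\<exists>B. is_upper_inverse A B)"

definition upper_inv :: "(nat \<Rightarrow> nat \<Rightarrow> 'b) \<Rightarrow> nat \<Rightarrow> nat \<Rightarrow> 'b::real_normed_field" where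
  "upper_inv A = (THE B. is_upper_inverse A B)"

end

theory Submission
  imports Defs "HOL-Complex_Analysis.Conformal_Mappings"
begin

text \<open>The chain is observed on the grids \<open>n / (m + 1)\<close>.  For the skeleton, the function
  \<open>u \<mapsto> E\<^sub>u[exp(- q \<tau>\<^sub>x), \<tau>\<^sub>x < \<tau>\<^sub>z]\<close> satisfies a one-step equation by the simple Markov property, and the
  Laplace transform of the excursions from \<open>z\<close> is a geometric sum over the exit index.  By right
  continuity the skeleton quantities converge, and conservativity of \<open>Q\<close> lets one pass to the limit
  in the one-step equation, so that no strong Markov property is needed: the limit \<open>H\<^sub>x\<close> satisfies
  \<open>Q H\<^sub>x = q H\<^sub>x\<close> off \<open>{x, z}\<close>, with \<open>H\<^sub>x(x) = 1\<close> and \<open>H\<^sub>x = 0\<close> from \<open>z\<close> on, and the excursion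
  Laplace transform equals \<open>Q(z, z - 1) H\<^sub>x(z - 1)\<close>.  As \<open>Q(v, v - 1) > 0\<close>, solutions of this
  system are determined downwards from \<open>z - 1\<close> up to a factor; hence \<open>H\<^sub>0(z - 1) = H\<^sub>0(x) H\<^sub>x(z - 1)\<close>,
  so that \<open>W\<^sup>q(x, z) = H\<^sub>0(x) / (Q(z, z - 1) H\<^sub>0(z - 1))\<close> solves the matrix equation, uniquely.  The
  Neumann series of \<open>W\<close> solves the same equation.\<close>

section \<open>Upper triangular matrices\<close>

text \<open>The hypotheses come in the wrong form: skip-freeness speaks of \<open>Q\<close> and
  irreducibility of hitting probabilities, whereas the argument needs that paths do not get from
  above \<open>z\<close> to below \<open>z\<close> without visiting \<open>z\<close>, and that
  \<open>Q z (z - 1) > 0\<close>. One estimate supplies both: if all rates from \<open>C\<close>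
  into a finite set \<open>B\<close> vanish, then almost surely no path started in \<open>C\<close>
  passes directly from \<open>C\<close> into \<open>B\<close>. It is a union bound over grid steps,
  confined to finitely many states because a path that is still alive has stayed bounded. The other
  obstacle is that upward jumps are unrestricted, so each one-step equation is an infinite sum, and
  explosion may cost the skeleton mass. Exchanging limit and sum rests on convergence of the total
  exit rates, not on a dominating function. Once hitting values are known to vanish above
  \<open>z\<close>, all sums against rows of \<open>Q\<close> are finite and the rest is linear
  algebra.\<close>

lemma mat_prod_finite:
  assumes "upper_mat B"
  shows "mat_prod A B x y = (\<Sum>u\<le>y. A x u * B u y)"
  unfolding mat_prod_def
  by (rule suminf_finite) (use assms in \<open>auto simp: upper_mat_def\<close>)

lemma triangular_imp_upper: "triangular A \<Longrightarrow> upper_mat A"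
  by (auto simp: triangular_def upper_mat_def)

lemma upper_mat_id: "upper_mat id_mat"
  by (auto simp: upper_mat_def id_mat_def)

lemma upper_mat_prod:
  assumes "upper_mat A" "upper_mat B"
  shows "upper_mat (mat_prod A B)"
  unfolding upper_mat_def
proof (intro allI impI)
  fix x y :: nat assume "y < x"
  then show "mat_prod A B x y = 0"
    using assms by (auto simp: mat_prod_finite upper_mat_def intro!: sum.neutral)
qed

lemma mat_prod_id_right: "mat_prod A id_mat = A"
  by (auto simp: fun_eq_iff mat_prod_finite[OF upper_mat_id] id_mat_def if_distrib sum.delta' cong: if_cong)

lemma mat_prod_id_left:
  assumes "upper_mat B"
  shows "mat_prod id_mat B = B"
proof (intro ext)
  fix x y
  have "mat_prod id_mat B x y = (\<Sum>u\<le>y. if x = u then B u y else 0)"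
    unfolding mat_prod_finite[OF assms] by (intro sum.cong) (auto simp: id_mat_def)
  also have "\<dots> = B x y"
    using assms by (auto simp: upper_mat_def)
  finally show "mat_prod id_mat B x y = B x y" .
qed

text \<open>The left factor stays arbitrary: \<open>Q\<close> has a subdiagonal and infinite rows,
  so it is not upper, yet it has to be moved across a product. Upper right factors keep all sums
  finite.\<close>

lemma mat_prod_assoc:
  assumes B: "upper_mat B" and C: "upper_mat C"
  shows "mat_prod (mat_prod A B) C = mat_prod A (mat_prod B C)"
proof (intro ext)
  fix x y
  have "mat_prod (mat_prod A B) C x y = (\<Sum>u\<le>y. \<Sum>v\<le>u. A x v * B v u * C u y)"
    by (simp add: mat_prod_finite B C sum_distrib_right)
  also have "\<dots> = (\<Sum>u\<le>y. \<Sum>v\<le>y. A x v * B v u * C u y)"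
    by (intro sum.cong refl sum.mono_neutral_left) (use B in \<open>auto simp: upper_mat_def\<close>)
  also have "\<dots> = (\<Sum>v\<le>y. \<Sum>u\<le>y. A x v * B v u * C u y)"
    by (rule sum.swap)
  also have "\<dots> = mat_prod A (mat_prod B C) x y"
    by (simp add: mat_prod_finite upper_mat_prod B C sum_distrib_left mult.assoc)
  finally show "mat_prod (mat_prod A B) C x y = mat_prod A (mat_prod B C) x y" .
qed

lemma upper_inv_unique:
  assumes A: "upper_mat A" and B: "is_upper_inverse A B"
  shows "upper_invertible A" "upper_inv A = B"
proof -
  show "upper_invertible A"
    using assms by (auto simp: upper_invertible_def)
  show "upper_inv A = B"
    unfolding upper_inv_def
  proof (rule the_equality)
    show "is_upper_inverse A B" by (fact B)
  next
    fix C assume C: "is_upper_inverse A C"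
    have "C = mat_prod C (mat_prod A B)"
      using B by (simp add: is_upper_inverse_def mat_prod_id_right)
    also have "\<dots> = mat_prod (mat_prod C A) B"
      using A B by (simp add: is_upper_inverse_def mat_prod_assoc)
    also have "\<dots> = B"
      using B C by (simp add: is_upper_inverse_def mat_prod_id_left)
    finally show "C = B" .
  qed
qed

lemma upper_mat_pow: "upper_mat A \<Longrightarrow> upper_mat (mat_pow A n)"
  by (induction n) (auto simp: upper_mat_id upper_mat_prod)

lemma mat_pow_commute:
  assumes "upper_mat A"
  shows "mat_prod A (mat_pow A n) = mat_prod (mat_pow A n) A"
proof (induction n)
  case 0
  then show ?case using assms by (simp add: mat_prod_id_left mat_prod_id_right)
next
  case (Suc n)
  then show ?case
    using assms by (simp add: mat_prod_assoc[symmetric] upper_mat_pow)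
qed

text \<open>Nilpotency: each triangular factor raises the index by at least one.\<close>

lemma mat_pow_eq_0:
  assumes "triangular A"
  shows "y < x + n \<Longrightarrow> mat_pow A n x y = 0"
proof (induction n arbitrary: y)
  case 0
  then show ?case by (simp add: id_mat_def)
next
  case (Suc n)
  have "mat_pow A n x u * A u y = 0" if "u \<le> y" for u
    using Suc.prems Suc.IH[of u] assms that
    by (cases "u = y") (auto simp: triangular_def)
  then show ?case
    using assms by (auto simp: mat_prod_finite triangular_imp_upper intro!: sum.neutral)
qed

lemma mat_pow_of_real:
  assumes "upper_mat A"
  shows "mat_pow (\<lambda>x y. of_real (A x y)) n x y = (of_real (mat_pow A n x y) :: 'a::real_normed_field)"
proof (induction n arbitrary: y)
  case 0
  then show ?case by (simp add: id_mat_def)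
next
  case (Suc n)
  have "upper_mat (\<lambda>x y. of_real (A x y) :: 'a)"
    using assms by (simp add: upper_mat_def)
  then show ?case using Suc assms by (simp add: mat_prod_finite)
qed

text \<open>For triangular \<open>A\<close> the Neumann series \<open>\<Sum>n. q\<^sup>n A\<^bsup>n+1\<^esup>\<close> terminates entrywise.\<close>

definition neumann :: "(nat \<Rightarrow> nat \<Rightarrow> 'b) \<Rightarrow> 'b \<Rightarrow> nat \<Rightarrow> nat \<Rightarrow> 'b::real_normed_field" where
  "neumann A q x y = (\<Sum>n<y. q ^ n * mat_pow A (Suc n) x y)"

text \<open>Lets each later step choose its own range: one that does not depend on the inner index
  of a matrix product, so that the two sums can be swapped, or one power more for an index shift.
  All terms with \<open>y <= x + n\<close> vanish by nilpotency.\<close>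

lemma neumann_eq_sum:
  assumes "triangular A" "finite N" "{n. x + n < y} \<subseteq> N"
  shows "neumann A q x y = (\<Sum>n\<in>N. q ^ n * mat_pow A (Suc n) x y)"
proof -
  have *: "mat_pow A (Suc n) x y = 0" if "n \<notin> {n. x + n < y}" for n
    using that by (intro mat_pow_eq_0 assms) auto
  have fin: "finite {n. x + n < y}"
    by (rule finite_subset[of _ "{..<y}"]) auto
  have "neumann A q x y = (\<Sum>n | x + n < y. q ^ n * mat_pow A (Suc n) x y)"
    unfolding neumann_def by (rule sum.mono_neutral_right) (use * in auto)
  also have "\<dots> = (\<Sum>n\<in>N. q ^ n * mat_pow A (Suc n) x y)"
    by (rule sum.mono_neutral_left) (use assms * in auto)
  finally show ?thesis .
qed

lemma neumann_sums:
  assumes "triangular A"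
  shows "(\<lambda>n. q ^ n * mat_pow A (Suc n) x y) sums neumann A q x y"
proof -
  have "(\<lambda>n. q ^ n * mat_pow A (Suc n) x y) sums (\<Sum>n<y. q ^ n * mat_pow A (Suc n) x y)"
    by (rule sums_finite) (use mat_pow_eq_0[OF assms, of y x "Suc _"] in auto)
  then show ?thesis by (simp add: neumann_def)
qed

lemma triangular_neumann:
  assumes "triangular A"
  shows "triangular (neumann A q)"
  unfolding triangular_def
proof (intro allI impI)
  fix x y :: nat assume "y \<le> x"
  then have "{n. x + n < y} = {}" by auto
  then show "neumann A q x y = 0"
    using neumann_eq_sum[OF assms, of "{}" x y q] by simp
qed

lemma neumann_fixpoint:
  assumes "triangular A"
  shows "neumann A q x y = A x y + q * mat_prod (neumann A q) A x y" (is ?right)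
    and "neumann A q x y = A x y + q * mat_prod A (neumann A q) x y" (is ?left)
proof -
  note A = triangular_imp_upper[OF assms]
  have "(\<Sum>u\<le>y. neumann A q x u * A u y) = (\<Sum>u\<le>y. \<Sum>n<y. q ^ n * mat_pow A (Suc n) x u * A u y)"
    by (intro sum.cong refl, subst neumann_eq_sum[OF assms, of "{..<y}"])
       (auto simp: sum_distrib_right)
  also have "\<dots> = (\<Sum>n<y. \<Sum>u\<le>y. q ^ n * mat_pow A (Suc n) x u * A u y)"
    by (rule sum.swap)
  also have "\<dots> = (\<Sum>n<y. q ^ n * mat_pow A (Suc (Suc n)) x y)"
    by (simp add: mat_prod_finite[OF A] sum_distrib_left sum_distrib_right mult.assoc)
  finally have r: "mat_prod (neumann A q) A x y = (\<Sum>n<y. q ^ n * mat_pow A (Suc (Suc n)) x y)"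
    by (simp add: mat_prod_finite[OF A])
  \<comment> \<open>One power more than in the definition, so that splitting off
    \<open>n = 0\<close> leaves exactly the \<open>y\<close> terms of \<open>r\<close>.\<close>
  have "neumann A q x y = (\<Sum>n<Suc y. q ^ n * mat_pow A (Suc n) x y)"
    by (rule neumann_eq_sum[OF assms]) auto
  also have "\<dots> = A x y + (\<Sum>n<y. q ^ Suc n * mat_pow A (Suc (Suc n)) x y)"
    by (subst sum.lessThan_Suc_shift) (simp add: mat_prod_id_left[OF A] del: power_Suc)
  also have "\<dots> = A x y + q * mat_prod (neumann A q) A x y"
    unfolding r by (simp add: sum_distrib_left mult.assoc del: mat_pow.simps)
  finally show right: ?right .
  have N: "upper_mat (neumann A q)"
    by (rule triangular_imp_upper[OF triangular_neumann[OF assms]])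
  have "(\<Sum>u\<le>y. A x u * neumann A q u y) = (\<Sum>u\<le>y. \<Sum>n<y. q ^ n * (A x u * mat_pow A (Suc n) u y))"
    by (simp add: neumann_def sum_distrib_left mult.left_commute)
  also have "\<dots> = (\<Sum>n<y. \<Sum>u\<le>y. q ^ n * (A x u * mat_pow A (Suc n) u y))"
    by (rule sum.swap)
  also have "\<dots> = (\<Sum>n<y. q ^ n * mat_prod A (mat_pow A (Suc n)) x y)"
    by (simp add: mat_prod_finite[OF upper_mat_pow[OF A]] sum_distrib_left del: mat_pow.simps)
  also have "\<dots> = (\<Sum>n<y. q ^ n * mat_pow A (Suc (Suc n)) x y)"
    by (simp add: mat_pow_commute[OF A] del: mat_pow.simps)
       (simp add: mat_pow.simps)
  finally have "mat_prod A (neumann A q) x y = mat_prod (neumann A q) A x y"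
    unfolding r by (simp add: mat_prod_finite[OF N])
  then show ?left using right by simp
qed

text \<open>The resolvent identity: since \<open>N = A + q N A = A + q A N\<close> for
  \<open>N = neumann A q\<close>, the inverse of \<open>I - q A\<close> is \<open>I + q N\<close>,
  and multiplying that by \<open>A\<close> on either side returns \<open>N\<close>.\<close>

lemma is_upper_inverse_neumann:
  assumes "triangular A"
  shows "is_upper_inverse (\<lambda>x y. id_mat x y - q * A x y) (\<lambda>x y. id_mat x y + q * neumann A q x y)"
    (is "is_upper_inverse ?L ?R")
    and "mat_prod (\<lambda>x y. id_mat x y + q * neumann A q x y) A = neumann A q"
    and "mat_prod A (\<lambda>x y. id_mat x y + q * neumann A q x y) = neumann A q"
proof -
  note A = triangular_imp_upper[OF assms]
  note N = triangular_imp_upper[OF triangular_neumann[OF assms, of q]]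
  have L: "upper_mat ?L" using A upper_mat_id[where 'a='a] by (auto simp: upper_mat_def)
  have R: "upper_mat ?R" using N upper_mat_id[where 'a='a] by (auto simp: upper_mat_def)
  have add_left: "mat_prod (\<lambda>x y. id_mat x y + c * C x y) D x y = D x y + c * mat_prod C D x y"
    if D: "upper_mat D" for c :: 'a and C D x y
  proof -
    have "mat_prod (\<lambda>x y. id_mat x y + c * C x y) D x y = mat_prod id_mat D x y + c * mat_prod C D x y"
      by (simp add: mat_prod_finite[OF D] algebra_simps sum.distrib sum_distrib_left)
    then show ?thesis by (simp add: mat_prod_id_left[OF D])
  qed
  have RA: "mat_prod ?R A x y = neumann A q x y" for x y
    using add_left[OF A, of q "neumann A q"] neumann_fixpoint(1)[OF assms, of q] by simp
  have AR: "mat_prod A ?R x y = neumann A q x y" for x y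
  proof -
    have "mat_prod A ?R x y = mat_prod A id_mat x y + q * mat_prod A (neumann A q) x y"
      by (simp add: mat_prod_finite[OF R] mat_prod_finite[OF N] mat_prod_finite[OF upper_mat_id]
          algebra_simps sum.distrib sum_distrib_left)
    then show ?thesis
      using neumann_fixpoint(2)[OF assms, of q] by (simp add: mat_prod_id_right)
  qed
  have "mat_prod ?L ?R x y = id_mat x y" for x y
    using add_left[OF R, of "- q" A] AR by simp
  moreover have "mat_prod ?R ?L x y = id_mat x y" for x y
  proof -
    have "mat_prod ?R ?L x y = mat_prod ?R id_mat x y - q * mat_prod ?R A x y"
      by (simp add: mat_prod_finite[OF L] mat_prod_finite[OF A] mat_prod_finite[OF upper_mat_id]
          algebra_simps sum.distrib sum_subtractf sum_distrib_left)
    then show ?thesis by (simp add: RA mat_prod_id_right)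
  qed
  ultimately show "is_upper_inverse ?L ?R"
    using R by (auto simp: is_upper_inverse_def fun_eq_iff)
  show "mat_prod ?R A = neumann A q" "mat_prod A ?R = neumann A q"
    by (auto simp: fun_eq_iff RA AR)
qed

lemma neumann_of_real:
  assumes "upper_mat A"
  shows "neumann (\<lambda>x y. of_real (A x y)) (of_real q) x y = of_real (neumann A q x y)"
  by (simp add: neumann_def mat_pow_of_real[OF assms] del: mat_pow.simps)

lemma neumann_poly:
  "\<exists>p. \<forall>q. neumann A q x y = poly p q"
  by (rule exI[of _ "\<Sum>n<y. monom (mat_pow A (Suc n) x y) n"])
     (simp add: neumann_def poly_sum poly_monom mult.commute del: mat_pow.simps)

section \<open>Entire extensions in \<open>q\<close>\<close>

lemma holomorphic_eq_if_eq_nonneg_reals: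
  assumes "f holomorphic_on UNIV" "g holomorphic_on UNIV"
    and eq: "\<And>q. 0 \<le> q \<Longrightarrow> f (complex_of_real q) = g (complex_of_real q)"
  shows "f = g"
proof -
  have "(\<lambda>w. f w - g w) z = 0" for z
  proof (rule analytic_continuation[of "\<lambda>w. f w - g w" UNIV "complex_of_real ` {0..}" 0])
    show "(\<lambda>w. f w - g w) holomorphic_on UNIV"
      using assms by (intro holomorphic_intros)
    show "0 islimpt complex_of_real ` {0..}"
      unfolding islimpt_approachable
    proof (intro allI impI)
      fix e :: real assume "0 < e"
      then show "\<exists>x'\<in>complex_of_real ` {0..}. x' \<noteq> 0 \<and> dist x' 0 < e"
        by (intro bexI[of _ "complex_of_real (e / 2)"]) (auto simp del: of_real_divide)
    qed
  qed (use eq in auto)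
  then show ?thesis by (auto simp: fun_eq_iff)
qed

text \<open>By the identity theorem the extension is unique, so each claim about an arbitrary
  extension \<open>V\<close> becomes one about a terminating Neumann series with complex
  entries.\<close>

lemma entire_extension_neumann:
  assumes W: "triangular (W 0)"
    and neumann: "\<And>q. 0 \<le> q \<Longrightarrow> W q = neumann (W 0) q"
  shows "entire_extension W V \<longleftrightarrow> V = neumann (\<lambda>x y. complex_of_real (W 0 x y))"
proof
  let ?N = "neumann (\<lambda>x y. complex_of_real (W 0 x y))"
  have N: "entire_extension W ?N"
    unfolding entire_extension_def
  proof (intro allI conjI impI)
    fix x y
    show "(\<lambda>q. ?N q x y) holomorphic_on UNIV"
      unfolding neumann_def by (intro holomorphic_intros)
    fix q :: real assume "0 \<le> q"
    then show "?N (complex_of_real q) x y = complex_of_real (W q x y)"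
      using neumann[of q] by (simp add: neumann_of_real triangular_imp_upper[OF W])
  qed
  show "entire_extension W V" if "V = ?N" using N that by simp
  assume V: "entire_extension W V"
  have "(\<lambda>q. V q x y) = (\<lambda>q. ?N q x y)" for x y
    by (rule holomorphic_eq_if_eq_nonneg_reals) (use V N in \<open>auto simp: entire_extension_def\<close>)
  then show "V = ?N" by (auto simp: fun_eq_iff)
qed

section \<open>Paths and their skeletons\<close>

lemma cadlag_killed_None_iff:
  "cadlag_killed p \<Longrightarrow> 0 \<le> t \<Longrightarrow> p t = None \<longleftrightarrow> explosion_time p \<le> ereal t"
  by (auto simp: cadlag_killed_def)

lemma cadlag_killed_alive:
  assumes "cadlag_killed p" "0 \<le> s" "s \<le> t" "p t = Some y"
  obtains y' where "p s = Some y'"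
proof -
  have "\<not> explosion_time p \<le> ereal t"
    using cadlag_killed_None_iff[OF assms(1), of t] assms by auto
  moreover have "ereal s \<le> ereal t" using assms by simp
  ultimately have "\<not> explosion_time p \<le> ereal s"
    by (meson order_trans)
  then have "p s \<noteq> None"
    using cadlag_killed_None_iff[OF assms(1), of s] assms by auto
  then show ?thesis using that by auto
qed

text \<open>Holds for dead paths too: death is permanent, since \<open>None\<close> is tied to the
  explosion time.\<close>

lemma cadlag_killed_right_const:
  assumes p: "cadlag_killed p" and t: "0 \<le> t"
  obtains e where "e > 0" "\<And>s. t \<le> s \<Longrightarrow> s < t + e \<Longrightarrow> p s = p t"
proof (cases "explosion_time p \<le> ereal t")
  case True
  have "p s = p t" if "t \<le> s" for s
  proof -
    have "ereal t \<le> ereal s" using that by simp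
    then have "explosion_time p \<le> ereal s" using True by (rule order_trans[rotated])
    then have "p s = None" "p t = None"
      using True cadlag_killed_None_iff[OF p] t that by auto
    then show ?thesis by simp
  qed
  then show ?thesis using that[of 1] zero_less_one by blast
next
  case False
  then have "\<forall>\<^sub>F s in at_right t. p s = p t"
    using p t by (auto simp: cadlag_killed_def)
  then obtain b where b: "b > t" "\<And>y. t < y \<Longrightarrow> y < b \<Longrightarrow> p y = p t"
    by (auto simp: eventually_at_right_field)
  show ?thesis
  proof (rule that[of "b - t"])
    show "p s = p t" if "t \<le> s" "s < t + (b - t)" for s
      using b(2)[of s] that by (cases "s = t") auto
  qed (use b in auto)
qed

text \<open>A common form of both random times: \<open>hit_time\<close> starts at \<open>0\<close>,
  \<open>return_time\<close> at the exit time. Attainment, grid approximation and measurability then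
  need proof only once.\<close>

definition entry_time :: "ereal \<Rightarrow> nat set \<Rightarrow> path \<Rightarrow> ereal" where
  "entry_time a A p = Inf {ereal t | t. a < ereal t \<and> p t \<in> Some ` A}"

lemma hit_time_eq_entry_time: "hit_time A p = entry_time 0 A p"
  by (simp add: hit_time_def entry_time_def)

lemma return_time_eq_entry_time: "return_time z p = entry_time (exit_time z p) {z} p"
  by (simp add: return_time_def entry_time_def)

lemma entry_time_le: "a < ereal t \<Longrightarrow> p t = Some y \<Longrightarrow> y \<in> A \<Longrightarrow> entry_time a A p \<le> ereal t"
  unfolding entry_time_def by (rule Inf_lower) auto

lemma entry_time_less_iff:
  "entry_time a A p < c \<longleftrightarrow> (\<exists>t. a < ereal t \<and> ereal t < c \<and> p t \<in> Some ` A)"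
  unfolding entry_time_def Inf_less_iff by auto

lemma entry_time_ge: "a \<le> entry_time a A p"
  unfolding entry_time_def by (rule Inf_greatest) auto

lemma hit_time_le: "0 < t \<Longrightarrow> p t = Some y \<Longrightarrow> y \<in> A \<Longrightarrow> hit_time A p \<le> ereal t"
  unfolding hit_time_eq_entry_time by (rule entry_time_le) auto

lemma hit_time_less_iff:
  "hit_time A p < c \<longleftrightarrow> (\<exists>t>0. ereal t < c \<and> p t \<in> Some ` A)"
  unfolding hit_time_eq_entry_time entry_time_less_iff by simp

lemma hit_time_nonneg: "0 \<le> hit_time A p"
  unfolding hit_time_eq_entry_time by (rule entry_time_ge)

lemma hit_time_antimono: "A \<subseteq> B \<Longrightarrow> hit_time B p \<le> hit_time A p"
  unfolding hit_time_def by (rule Inf_superset_mono) auto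

text \<open>Right continuity in a discrete space gives more than an attained infimum: a whole
  interval from \<tau> on is spent in one state, which no sufficiently fine grid can miss. The
  infimum may equal \<open>a\<close>, although \<open>a\<close> itself is excluded from the
  competing times.\<close>

lemma entry_time_attained:
  assumes p: "cadlag_killed p" and a: "0 \<le> a" and \<tau>: "entry_time a A p = ereal \<tau>"
  obtains e y where "0 \<le> \<tau>" "e > 0" "y \<in> A" "\<And>s. \<tau> \<le> s \<Longrightarrow> s < \<tau> + e \<Longrightarrow> p s = Some y"
proof -
  have "0 \<le> ereal \<tau>" using order_trans[OF a entry_time_ge] \<tau> by metis
  then have "0 \<le> \<tau>" by simp
  then obtain e where e: "e > 0" "\<And>s. \<tau> \<le> s \<Longrightarrow> s < \<tau> + e \<Longrightarrow> p s = p \<tau>"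
    using cadlag_killed_right_const[OF p] by metis
  have "entry_time a A p < ereal (\<tau> + e)" using \<tau> e by simp
  then obtain t y where t: "a < ereal t" "t < \<tau> + e" "p t = Some y" "y \<in> A"
    unfolding entry_time_less_iff by auto
  then have "\<tau> \<le> t" using entry_time_le[of a t p y A] \<tau> by simp
  then have "p \<tau> = Some y" using e(2)[of t] t by simp
  then show ?thesis using that[OF \<open>0 \<le> \<tau>\<close> e(1) \<open>y \<in> A\<close>] e(2) by simp
qed

lemma hit_time_attained:
  assumes "cadlag_killed p" "hit_time A p = ereal \<tau>"
  obtains e y where "0 \<le> \<tau>" "e > 0" "y \<in> A" "\<And>s. \<tau> \<le> s \<Longrightarrow> s < \<tau> + e \<Longrightarrow> p s = Some y"
  using assms entry_time_attained[of p 0 A \<tau>] unfolding hit_time_eq_entry_time by auto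

section \<open>Grids and first grid visits\<close>

definition grid :: "nat \<Rightarrow> nat \<Rightarrow> real" where
  "grid m n = real n / real (Suc m)"

lemma grid_nonneg [simp]: "0 \<le> grid m n"
  by (simp add: grid_def)

lemma grid_0 [simp]: "grid m 0 = 0"
  by (simp add: grid_def)

lemma grid_pos [simp]: "0 < grid m n \<longleftrightarrow> 0 < n"
  by (simp add: grid_def zero_less_divide_iff)

lemma grid_less_iff [simp]: "grid m n < grid m k \<longleftrightarrow> n < k"
  by (simp add: grid_def divide_strict_right_mono divide_less_cancel)

lemma grid_le_iff [simp]: "grid m n \<le> grid m k \<longleftrightarrow> n \<le> k"
  by (metis grid_less_iff not_le)

lemma grid_add: "grid m (n + k) = grid m n + grid m k"
  by (simp add: grid_def add_divide_distrib)

lemma grid_Suc: "grid m (Suc n) = grid m n + grid m 1"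
  using grid_add[of m n 1] by simp

lemma eventually_grid_between:
  assumes "0 \<le> t" "t < u"
  shows "\<forall>\<^sub>F m in sequentially. \<exists>n\<ge>1. t < grid m n \<and> grid m n < u"
proof -
  have "\<forall>\<^sub>F m in sequentially. inverse (real (Suc m)) < u - t"
    using assms by (intro order_tendstoD[OF LIMSEQ_inverse_real_of_nat]) auto
  then show ?thesis
  proof eventually_elim
    case (elim m)
    define n where "n = nat \<lfloor>t * real (Suc m)\<rfloor> + 1"
    have nn: "0 \<le> t * real (Suc m)" using assms by simp
    then have "real n = of_int \<lfloor>t * real (Suc m)\<rfloor> + 1"
      unfolding n_def by simp
    then have "t * real (Suc m) < real n" "real n \<le> t * real (Suc m) + 1"
      by linarith+
    then have "t < grid m n" "grid m n \<le> t + inverse (real (Suc m))"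
      unfolding grid_def by (simp_all add: field_simps del: of_nat_Suc)
    then show ?case using elim by (intro exI[of _ n]) (auto simp: n_def)
  qed
qed

lemma eventually_grid_entry:
  assumes p: "cadlag_killed p" and a: "0 \<le> a" and \<tau>: "entry_time a A p = ereal \<tau>" and e: "e > 0"
  shows "\<forall>\<^sub>F m in sequentially. \<exists>n\<ge>1. \<tau> < grid m n \<and> grid m n < \<tau> + e \<and> p (grid m n) \<in> Some ` A"
proof -
  obtain e' y where e': "0 \<le> \<tau>" "e' > 0" "y \<in> A" "\<And>s. \<tau> \<le> s \<Longrightarrow> s < \<tau> + e' \<Longrightarrow> p s = Some y"
    using entry_time_attained[OF p a \<tau>] by metis
  have "\<forall>\<^sub>F m in sequentially. \<exists>n\<ge>1. \<tau> < grid m n \<and> grid m n < \<tau> + min e e'"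
    using e e' by (intro eventually_grid_between) auto
  then show ?thesis
  proof eventually_elim
    case (elim m)
    then obtain n where n: "n \<ge> 1" "\<tau> < grid m n" "grid m n < \<tau> + min e e'" by auto
    then have "p (grid m n) = Some y" using e'(4)[of "grid m n"] by auto
    then show ?case using n e'(3) by (intro exI[of _ n]) auto
  qed
qed

text \<open>For times counted from \<open>0\<close>, no positive grid point can visit
  \<open>A\<close> before the hitting time, so the first grid visit overshoots it by less than
  \<open>e\<close>. For a later start \<open>a\<close> there may be visits before \<open>a\<close>,
  and only \<open>eventually_grid_entry\<close> remains.\<close>

lemma eventually_grid_first_hit:
  assumes p: "cadlag_killed p" and \<tau>: "hit_time A p = ereal \<tau>" and e: "e > 0"
  shows "\<forall>\<^sub>F m in sequentially. \<exists>n\<ge>1. \<tau> \<le> grid m n \<and> grid m n < \<tau> + e \<and> p (grid m n) \<in> Some ` A \<and>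
      (\<forall>k\<in>{1..<n}. p (grid m k) \<notin> Some ` A)"
  using eventually_grid_entry[OF p order_refl \<tau>[unfolded hit_time_eq_entry_time] e]
proof eventually_elim
  case (elim m)
  then obtain n0 where n0: "n0 \<ge> 1" "grid m n0 < \<tau> + e" "p (grid m n0) \<in> Some ` A" by auto
  define n where "n = (LEAST n. n \<ge> 1 \<and> p (grid m n) \<in> Some ` A)"
  have n: "n \<ge> 1 \<and> p (grid m n) \<in> Some ` A"
    unfolding n_def by (rule LeastI[of _ n0]) (use n0 in auto)
  have "n \<le> n0" unfolding n_def by (rule Least_le) (use n0 in auto)
  then have "grid m n < \<tau> + e" using n0 grid_le_iff[of m n n0] by linarith
  moreover have "\<tau> \<le> grid m n"
    using n hit_time_le[of "grid m n" p _ A] \<tau> by force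
  moreover have "\<forall>k\<in>{1..<n}. p (grid m k) \<notin> Some ` A"
    unfolding n_def using not_less_Least[of _ "\<lambda>n. n \<ge> 1 \<and> p (grid m n) \<in> Some ` A"] by auto
  ultimately show ?case using n by auto
qed

text \<open>The sets depend on the index so that one notion serves both hitting and excursions.
  Index \<open>0\<close> is left free, in accordance with hitting times that count only
  \<open>t > 0\<close>.\<close>

definition skeleton_path :: "path \<Rightarrow> (nat \<Rightarrow> nat set) \<Rightarrow> nat \<Rightarrow> nat \<Rightarrow> nat \<Rightarrow> bool" where
  "skeleton_path p B m n x \<longleftrightarrow> (\<forall>k\<in>{1..<n}. p (grid m k) \<in> Some ` B k) \<and> p (grid m n) = Some x"

lemma suminf_single:
  fixes f :: "nat \<Rightarrow> 'a::{t2_space, comm_monoid_add}"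
  assumes "\<And>n. n \<noteq> i \<Longrightarrow> f n = 0"
  shows "suminf f = f i"
  using suminf_finite[of "{i}" f] assms by simp

lemma tendsto_if_eventually_near:
  fixes f :: "real \<Rightarrow> 'a::topological_space"
  assumes f: "isCont f t"
    and S: "\<And>e. e > 0 \<Longrightarrow> \<forall>\<^sub>F m in F. \<exists>s. \<bar>s - t\<bar> < e \<and> S m = f s"
  shows "(S \<longlongrightarrow> f t) F"
proof (rule topological_tendstoI)
  fix U assume "open U" "f t \<in> U"
  moreover have "(f \<longlongrightarrow> f t) (nhds t)"
    using f by (simp add: isCont_def tendsto_at_iff_tendsto_nhds)
  ultimately have "\<forall>\<^sub>F s in nhds t. f s \<in> U"
    by (simp add: tendsto_def)
  then obtain d where d: "d > 0" "\<And>s. dist s t < d \<Longrightarrow> f s \<in> U"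
    by (auto simp: eventually_nhds_metric)
  show "\<forall>\<^sub>F m in F. S m \<in> U"
    using S[OF d(1)] by eventually_elim (use d(2) in \<open>auto simp: dist_real_def\<close>)
qed

section \<open>Discounted hitting of \<open>x\<close> before \<open>z\<close>\<close>

definition hit_weight :: "real \<Rightarrow> nat \<Rightarrow> nat \<Rightarrow> path \<Rightarrow> real" where
  "hit_weight q x z p =
     (if hit_time {x} p < hit_time {z} p then exp (- q * real_of_ereal (hit_time {x} p)) else 0)"

text \<open>At most one summand is nonzero. Written as a sum over the hitting index, the weight can
  be integrated term by term, and \<open>ennreal\<close> spares all summability conditions.\<close>

definition skeleton_hit_weight :: "real \<Rightarrow> nat \<Rightarrow> nat \<Rightarrow> nat \<Rightarrow> path \<Rightarrow> ennreal" where
  "skeleton_hit_weight q x z m p =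
     (\<Sum>n. if skeleton_path p (\<lambda>_. - {x, z}) m (Suc n) x then ennreal (exp (- q * grid m (Suc n))) else 0)"

lemma skeleton_hit_weight_eq:
  assumes "skeleton_path p (\<lambda>_. - {x, z}) m (Suc n) x"
  shows "skeleton_hit_weight q x z m p = ennreal (exp (- q * grid m (Suc n)))"
proof -
  have "\<not> skeleton_path p (\<lambda>_. - {x, z}) m (Suc k) x" if "k \<noteq> n" for k
  proof (cases "k < n")
    case True
    then show ?thesis using assms by (auto simp: skeleton_path_def dest!: bspec[of _ _ "Suc k"])
  next
    case False
    then show ?thesis using assms that by (auto simp: skeleton_path_def dest!: bspec[of _ _ "Suc n"])
  qed
  then show ?thesis
    unfolding skeleton_hit_weight_def by (subst suminf_single[of n]) (use assms in auto)
qed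

lemma skeleton_hit_weight_le_1:
  assumes "0 \<le> q"
  shows "skeleton_hit_weight q x z m p \<le> 1"
proof (cases "\<exists>n. skeleton_path p (\<lambda>_. - {x, z}) m (Suc n) x")
  case True
  then show ?thesis
    using assms by (auto simp: skeleton_hit_weight_eq intro!: mult_nonneg_nonneg)
next
  case False
  then show ?thesis by (simp add: skeleton_hit_weight_def)
qed

lemma tendsto_skeleton_hit_weight:
  assumes p: "cadlag_killed p" and "x \<noteq> z"
  shows "(\<lambda>m. skeleton_hit_weight q x z m p) \<longlonglongrightarrow> ennreal (hit_weight q x z p)"
proof (cases "hit_time {x} p < hit_time {z} p")
  case True
  then have "\<bar>hit_time {x} p\<bar> \<noteq> \<infinity>"
    using hit_time_nonneg[of "{x}" p] by auto
  then obtain t where t: "hit_time {x} p = ereal t" by auto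
  \<comment> \<open>\<open>u\<close> separates the two hitting times: a grid visit to
    \<open>x\<close> before \<open>u\<close> comes too early for the grid to have seen
    \<open>z\<close>.\<close>
  obtain u where u: "t < u" "ereal u < hit_time {z} p"
    using ereal_dense2[OF True[unfolded t]] by auto
  have "(\<lambda>m. skeleton_hit_weight q x z m p) \<longlonglongrightarrow> ennreal (exp (- q * t))"
  proof (rule tendsto_if_eventually_near[where f = "\<lambda>t. ennreal (exp (- q * t))"])
    show "isCont (\<lambda>t. ennreal (exp (- q * t))) t"
      by (intro continuous_intros)
    fix e :: real assume "e > 0"
    then have "min e (u - t) > 0" using u by auto
    from eventually_grid_first_hit[OF p t this]
    show "\<forall>\<^sub>F m in sequentially. \<exists>s. \<bar>s - t\<bar> < e \<and> skeleton_hit_weight q x z m p = ennreal (exp (- q * s))"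
    proof eventually_elim
      case (elim m)
      then obtain n where n: "n \<ge> 1" "t \<le> grid m n" "grid m n < t + min e (u - t)"
        "p (grid m n) = Some x" "\<forall>k\<in>{1..<n}. p (grid m k) \<noteq> Some x" by auto
      have "p (grid m k) \<in> Some ` (- {x, z})" if k: "k \<in> {1..<n}" for k
      proof -
        obtain y where y: "p (grid m k) = Some y"
          by (rule cadlag_killed_alive[OF p _ _ n(4), of "grid m k"]) (use k in auto)
        have "y \<noteq> z"
        proof
          assume "y = z"
          then have "hit_time {z} p \<le> ereal (grid m k)"
            using y k by (intro hit_time_le[of _ _ z]) auto
          also have "ereal (grid m k) < ereal (grid m n)" using k by simp
          also have "\<dots> < ereal u" using n(3) by simp
          finally show False using u by simp
        qed
        then show ?thesis using y n(5) k by auto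
      qed
      moreover obtain n' where n': "n = Suc n'" using n(1) by (cases n) auto
      ultimately have "skeleton_path p (\<lambda>_. - {x, z}) m (Suc n') x"
        using n by (auto simp: skeleton_path_def)
      then show ?case
        using n n' by (intro exI[of _ "grid m n"]) (auto simp: skeleton_hit_weight_eq)
    qed
  qed
  then show ?thesis using True by (simp add: hit_weight_def t)
next
  case False
  have "\<forall>\<^sub>F m in sequentially. \<forall>n. \<not> skeleton_path p (\<lambda>_. - {x, z}) m (Suc n) x"
  proof (cases "hit_time {x} p = \<infinity>")
    case True
    have "\<not> skeleton_path p (\<lambda>_. - {x, z}) m (Suc n) x" for m n
    proof
      assume "skeleton_path p (\<lambda>_. - {x, z}) m (Suc n) x"
      then have "hit_time {x} p \<le> ereal (grid m (Suc n))"
        by (intro hit_time_le[of _ _ x]) (auto simp: skeleton_path_def)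
      then show False using True by auto
    qed
    then show ?thesis by simp
  next
    case fin: False
    then have "\<bar>hit_time {x} p\<bar> \<noteq> \<infinity>" "\<bar>hit_time {z} p\<bar> \<noteq> \<infinity>"
      using hit_time_nonneg[of "{x}" p] hit_time_nonneg[of "{z}" p] False by auto
    then obtain t s where t: "hit_time {x} p = ereal t" and s: "hit_time {z} p = ereal s" by auto
    obtain e where e: "e > 0" "\<And>v. s \<le> v \<Longrightarrow> v < s + e \<Longrightarrow> p v = Some z"
      using hit_time_attained[OF p s] by auto
    obtain e' where e': "e' > 0" "\<And>v. t \<le> v \<Longrightarrow> v < t + e' \<Longrightarrow> p v = Some x"
      using hit_time_attained[OF p t] by auto
    \<comment> \<open>Each state is held on an interval after its hitting time, so the two times
      cannot coincide; a fine grid then sees \<open>z\<close> before time \<open>t\<close>.\<close>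
    have "s \<noteq> t" using e(1) e(2)[of s] e'(1) e'(2)[of s] \<open>x \<noteq> z\<close> by auto
    then have "t - s > 0" using False by (auto simp: t s)
    from eventually_grid_first_hit[OF p s this] show ?thesis
    proof eventually_elim
      case (elim m)
      then obtain k where k: "k \<ge> 1" "grid m k < t" "p (grid m k) = Some z" by auto
      have "\<not> skeleton_path p (\<lambda>_. - {x, z}) m (Suc n) x" for n
      proof
        assume *: "skeleton_path p (\<lambda>_. - {x, z}) m (Suc n) x"
        then have "hit_time {x} p \<le> ereal (grid m (Suc n))"
          by (intro hit_time_le[of _ _ x]) (auto simp: skeleton_path_def)
        then have "grid m k < grid m (Suc n)" using k t by (simp del: grid_less_iff)
        then have "k < Suc n" by simp
        then show False using * k by (auto simp: skeleton_path_def dest!: bspec[of _ _ k])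
      qed
      then show ?case by simp
    qed
  qed
  then have "\<forall>\<^sub>F m in sequentially. skeleton_hit_weight q x z m p = ennreal (hit_weight q x z p)"
    by eventually_elim (use False in \<open>simp add: skeleton_hit_weight_def hit_weight_def\<close>)
  then show ?thesis by (rule tendsto_eventually)
qed

section \<open>Discounted excursions from \<open>z\<close>\<close>

definition excursion_weight :: "real \<Rightarrow> nat \<Rightarrow> nat \<Rightarrow> path \<Rightarrow> real" where
  "excursion_weight q x z p =
     (if hit_time {x} p < return_time z p
      then exp (- q * real_of_ereal (hit_time {x} p - exit_time z p)) else 0)"

text \<open>In a skeleton excursion, \<open>j\<close> counts the grid points spent at \<open>z\<close>, and \<open>n\<close> the grid steps
  from the first point off \<open>z\<close> to the first visit of \<open>x\<close>.\<close>

definition excursion_sets :: "nat \<Rightarrow> nat \<Rightarrow> nat \<Rightarrow> nat \<Rightarrow> nat set" where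
  "excursion_sets x z j k = (if k \<le> j then {z} else - {x, z})"

definition skeleton_excursion_weight :: "real \<Rightarrow> nat \<Rightarrow> nat \<Rightarrow> nat \<Rightarrow> path \<Rightarrow> ennreal" where
  "skeleton_excursion_weight q x z m p =
     (\<Sum>j n. if skeleton_path p (excursion_sets x z j) m (Suc (j + n)) x
             then ennreal (exp (- q * grid m n)) else 0)"

text \<open>\<open>x\<close> can be visited only at the last index, which fixes
  \<open>j + n\<close>; then \<open>j\<close> is determined by the first index off
  \<open>z\<close>.\<close>

lemma skeleton_excursion_unique:
  assumes xz: "x \<noteq> z"
    and 1: "skeleton_path p (excursion_sets x z j) m (Suc (j + n)) x"
    and 2: "skeleton_path p (excursion_sets x z j') m (Suc (j' + n')) x"
  shows "j = j' \<and> n = n'"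
proof -
  have nx: "p (grid m k) \<noteq> Some x"
    if "skeleton_path p (excursion_sets x z i) m N x" "k \<in> {1..<N}" for i N k
    using that xz by (auto simp: skeleton_path_def excursion_sets_def split: if_splits dest!: bspec[of _ _ k])
  have N: "j + n = j' + n'"
    using nx[OF 1, of "Suc (j' + n')"] nx[OF 2, of "Suc (j + n)"] 1 2
    by (auto simp: skeleton_path_def) (metis nat_neq_iff)
  have "\<not> j < j'"
    if 1: "skeleton_path p (excursion_sets x z j) m (Suc (j + n)) x"
      and 2: "skeleton_path p (excursion_sets x z j') m (Suc (j' + n')) x"
      and N: "j + n = j' + n'" for j n j' n'
  proof
    assume "j < j'"
    then have "Suc j \<in> {1..<Suc (j + n)}" "Suc j \<in> {1..<Suc (j' + n')}" using N by auto
    then have "p (grid m (Suc j)) \<in> Some ` excursion_sets x z j (Suc j)"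
       "p (grid m (Suc j)) \<in> Some ` excursion_sets x z j' (Suc j)"
      using 1 2 unfolding skeleton_path_def by blast+
    then show False using \<open>j < j'\<close> by (auto simp: excursion_sets_def)
  qed
  from this[OF 1 2 N] this[OF 2 1 N[symmetric]] N show ?thesis by auto
qed

lemma skeleton_excursion_weight_eq:
  assumes xz: "x \<noteq> z" and 1: "skeleton_path p (excursion_sets x z j) m (Suc (j + n)) x"
  shows "skeleton_excursion_weight q x z m p = ennreal (exp (- q * grid m n))"
proof -
  have inner: "(\<Sum>n'. if skeleton_path p (excursion_sets x z j') m (Suc (j' + n')) x
      then ennreal (exp (- q * grid m n')) else 0) = (if j' = j then ennreal (exp (- q * grid m n)) else 0)" for j'
  proof -
    have *: "skeleton_path p (excursion_sets x z j') m (Suc (j' + n')) x \<longleftrightarrow> j' = j \<and> n' = n" for n'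
      using 1 skeleton_excursion_unique[OF xz 1, of j' n'] by blast
    show ?thesis
      unfolding * by (subst suminf_single[of n]) simp_all
  qed
  show ?thesis
    unfolding skeleton_excursion_weight_def inner by (subst suminf_single[of j]) auto
qed

lemma skeleton_excursion_weight_le_1:
  assumes "0 \<le> q" "x \<noteq> z"
  shows "skeleton_excursion_weight q x z m p \<le> 1"
proof (cases "\<exists>j n. skeleton_path p (excursion_sets x z j) m (Suc (j + n)) x")
  case True
  then show ?thesis
    using assms by (auto simp: skeleton_excursion_weight_eq intro!: mult_nonneg_nonneg)
next
  case False
  then show ?thesis by (simp add: skeleton_excursion_weight_def)
qed

lemma tendsto_skeleton_excursion_weight:
  assumes p: "cadlag_killed p" and xz: "x \<noteq> z"
  shows "(\<lambda>m. skeleton_excursion_weight q x z m p) \<longlonglongrightarrow> ennreal (excursion_weight q x z p)"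
proof (cases "hit_time {x} p < return_time z p")
  case True
  have le: "exit_time z p \<le> hit_time {x} p"
    unfolding exit_time_def using xz by (intro hit_time_antimono) auto
  then have "\<bar>hit_time {x} p\<bar> \<noteq> \<infinity>" "\<bar>hit_time (- {z}) p\<bar> \<noteq> \<infinity>"
    using hit_time_nonneg[of "{x}" p] hit_time_nonneg[of "- {z}" p] True by (auto simp: exit_time_def)
  then obtain t s where t: "hit_time {x} p = ereal t" and s: "hit_time (- {z}) p = ereal s" by auto
  obtain u where u: "t < u" "ereal u < return_time z p"
    using ereal_dense2[OF True[unfolded t]] by auto
  have "(\<lambda>m. skeleton_excursion_weight q x z m p) \<longlonglongrightarrow> ennreal (exp (- q * (t - s)))"
  proof (rule tendsto_if_eventually_near[where f = "\<lambda>t. ennreal (exp (- q * t))"])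
    show "isCont (\<lambda>t. ennreal (exp (- q * t))) (t - s)"
      by (intro continuous_intros)
    fix e :: real assume "e > 0"
    then have e': "min e (u - t) > 0" using u by auto
    \<comment> \<open>Compares the first grid visits to \<open>x\<close> and to the complement of
      \<open>z\<close>. Each overshoots its time by an amount in \<open>[0, e)\<close>, so the
      difference of the grid times misses \<open>t - s\<close> by less than
      \<open>e\<close>.\<close>
    show "\<forall>\<^sub>F m in sequentially.
        \<exists>r. \<bar>r - (t - s)\<bar> < e \<and> skeleton_excursion_weight q x z m p = ennreal (exp (- q * r))"
      using eventually_grid_first_hit[OF p t e'] eventually_grid_first_hit[OF p s \<open>e > 0\<close>]
    proof eventually_elim
      case (elim m)
      from elim(1) obtain N where N: "N \<ge> 1" "t \<le> grid m N" "grid m N < t + min e (u - t)"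
        "p (grid m N) = Some x" "\<forall>k\<in>{1..<N}. p (grid m k) \<noteq> Some x" by auto
      from elim(2) obtain J y where J: "J \<ge> 1" "s \<le> grid m J" "grid m J < s + e"
        "p (grid m J) = Some y" "y \<noteq> z" "\<forall>k\<in>{1..<J}. p (grid m k) \<notin> Some ` (- {z})" by auto
      have "J \<le> N" using J(6) N(1,4) xz by force
      define j where "j = J - 1"
      define n where "n = N - J"
      have idx: "J = Suc j" "N = Suc (j + n)" "grid m N = grid m J + grid m n"
        using J(1) \<open>J \<le> N\<close> by (auto simp: j_def n_def grid_add[symmetric])
      have "p (grid m k) \<in> Some ` excursion_sets x z j k" if k: "k \<in> {1..<N}" for k
      proof -
        obtain y' where y': "p (grid m k) = Some y'"
          by (rule cadlag_killed_alive[OF p _ _ N(4), of "grid m k"]) (use k in auto)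
        show ?thesis
        proof (cases "k \<le> j")
          case True
          then have "k \<in> {1..<J}" using k idx by auto
          then have "y' = z" using J(6) y' by auto
          then show ?thesis using y' True by (auto simp: excursion_sets_def)
        next
          case False
          have "y' \<noteq> z"
          proof
            assume "y' = z"
            then have "k \<noteq> J" using y' J by auto
            then have "J < k" using False idx by auto
            then have "grid m J < grid m k" by simp
            then have "s < grid m k" using J by linarith
            then have "return_time z p \<le> ereal (grid m k)"
              unfolding return_time_eq_entry_time
              by (intro entry_time_le[of _ _ _ z]) (use s y' \<open>y' = z\<close> in \<open>auto simp: exit_time_def\<close>)
            also have "ereal (grid m k) < ereal (grid m N)" using k by simp
            also have "\<dots> < ereal u" using N(3) by simp
            finally show False using u by simp
          qed
          then show ?thesis using y' N(5) k False by (auto simp: excursion_sets_def)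
        qed
      qed
      then have "skeleton_path p (excursion_sets x z j) m (Suc (j + n)) x"
        using N idx by (auto simp: skeleton_path_def)
      then have "skeleton_excursion_weight q x z m p = ennreal (exp (- q * grid m n))"
        by (rule skeleton_excursion_weight_eq[OF xz])
      then show ?case
        using J N idx by (intro exI[of _ "grid m n"]) auto
    qed
  qed
  then show ?thesis using True by (simp add: excursion_weight_def t s exit_time_def)
next
  case False
  have hit_le: "hit_time {x} p \<le> ereal (grid m (Suc (j + n)))"
    if "skeleton_path p (excursion_sets x z j) m (Suc (j + n)) x" for m j n
    using that by (intro hit_time_le[of _ _ x]) (auto simp: skeleton_path_def)
  have "\<forall>\<^sub>F m in sequentially. \<forall>j n. \<not> skeleton_path p (excursion_sets x z j) m (Suc (j + n)) x"
  proof (cases "hit_time {x} p = \<infinity>")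
    case True
    then have "\<not> skeleton_path p (excursion_sets x z j) m (Suc (j + n)) x" for m j n
      using hit_le[of j m n] by auto
    then show ?thesis by simp
  next
    case fin: False
    have exit: "0 \<le> exit_time z p"
      unfolding exit_time_def by (rule hit_time_nonneg)
    have le: "exit_time z p \<le> return_time z p"
      unfolding return_time_eq_entry_time by (rule entry_time_ge)
    then have "\<bar>hit_time {x} p\<bar> \<noteq> \<infinity>" "\<bar>return_time z p\<bar> \<noteq> \<infinity>" "\<bar>exit_time z p\<bar> \<noteq> \<infinity>"
      using hit_time_nonneg[of "{x}" p] exit False fin by auto
    then obtain t r s where t: "hit_time {x} p = ereal t" and r: "return_time z p = ereal r"
      and s: "exit_time z p = ereal s" by auto
    obtain e y where e: "e > 0" "y \<noteq> z" "\<And>v. s \<le> v \<Longrightarrow> v < s + e \<Longrightarrow> p v = Some y"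
      by (rule hit_time_attained[OF p s[unfolded exit_time_def]]) blast
    obtain e' where e': "e' > 0" "\<And>v. r \<le> v \<Longrightarrow> v < r + e' \<Longrightarrow> p v = Some z"
      using entry_time_attained[OF p exit r[unfolded return_time_eq_entry_time]] by auto
    obtain e'' where e'': "e'' > 0" "\<And>v. t \<le> v \<Longrightarrow> v < t + e'' \<Longrightarrow> p v = Some x"
      using hit_time_attained[OF p t] by auto
    have "s \<le> r" using le r s by simp
    \<comment> \<open>As the path is off \<open>z\<close> at \<open>s\<close>, in \<open>z\<close>
      at \<open>r\<close> and in \<open>x\<close> at \<open>t\<close>, the three times are distinct
      and \<open>s < r < t\<close>. A fine grid sees a state off \<open>z\<close>, then
      \<open>z\<close> again, before it can see \<open>x\<close>, which no excursion pattern
      allows.\<close>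
    have "s \<noteq> r" using e(1,2) e(3)[of s] e'(1) e'(2)[of s] by auto
    have "r \<noteq> t" using e''(1) e''(2)[of r] e'(1) e'(2)[of r] xz by auto
    then have "t - r > 0" using False by (auto simp: t r)
    have "r - s > 0" using \<open>s \<le> r\<close> \<open>s \<noteq> r\<close> by simp
    show ?thesis
      using eventually_grid_first_hit[OF p s[unfolded exit_time_def] \<open>r - s > 0\<close>]
        eventually_grid_entry[OF p exit r[unfolded return_time_eq_entry_time] \<open>t - r > 0\<close>]
    proof eventually_elim
      case (elim m)
      from elim(1) obtain J y where J: "J \<ge> 1" "grid m J < r" "p (grid m J) = Some y" "y \<noteq> z" by auto
      from elim(2) obtain K where K: "r < grid m K" "grid m K < t" "p (grid m K) = Some z" by auto
      have "\<not> skeleton_path p (excursion_sets x z j) m (Suc (j + n)) x" for j n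
      proof
        assume *: "skeleton_path p (excursion_sets x z j) m (Suc (j + n)) x"
        from hit_le[OF this] have "grid m K < grid m (Suc (j + n))" "grid m J < grid m K"
          using K J by (simp_all add: t del: grid_less_iff)
        then have lt: "K < Suc (j + n)" "J < K" by auto
        then have "p (grid m K) \<in> Some ` excursion_sets x z j K" "p (grid m J) \<in> Some ` excursion_sets x z j J"
          using * J(1) unfolding skeleton_path_def by auto
        then show False using J(3,4) K(3) lt by (auto simp: excursion_sets_def split: if_splits)
      qed
      then show ?case by simp
    qed
  qed
  then have "\<forall>\<^sub>F m in sequentially. skeleton_excursion_weight q x z m p = ennreal (excursion_weight q x z p)"
    by eventually_elim (use False in \<open>simp add: skeleton_excursion_weight_def excursion_weight_def\<close>)
  then show ?thesis by (rule tendsto_eventually)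
qed

text \<open>Explosion is the supremum of the passage times above levels, so being alive at
  \<open>t\<close> means that some level is reached only after \<open>t\<close>.\<close>

lemma cadlag_killed_bounded_before:
  assumes p: "cadlag_killed p" and t: "0 \<le> t" "p t = Some y"
  obtains N where "\<And>s. 0 < s \<Longrightarrow> s \<le> t \<Longrightarrow> \<exists>v<N. p s = Some v"
proof -
  have "ereal t < explosion_time p"
    using cadlag_killed_None_iff[OF p t(1)] t(2) by auto
  then obtain N where N: "ereal t < hit_time {N..} p"
    unfolding explosion_time_def less_SUP_iff by auto
  have "\<exists>v<N. p s = Some v" if s: "0 < s" "s \<le> t" for s
  proof -
    obtain v where v: "p s = Some v"
      using cadlag_killed_alive[OF p _ s(2) t(2)] s(1) by force
    have "v < N"
    proof (rule ccontr)
      assume "\<not> v < N"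
      then have "hit_time {N..} p \<le> ereal s" using that v by (intro hit_time_le[of _ _ v]) auto
      also have "\<dots> \<le> ereal t" using that by simp
      finally show False using N by simp
    qed
    then show ?thesis using v by auto
  qed
  then show ?thesis using that by metis
qed

text \<open>Turns a direct passage from \<open>C\<close> into \<open>B\<close> into one grid step
  from \<open>C\<close> into \<open>B\<close>, namely the step to the first grid visit to
  \<open>B\<close>. \<open>T\<close> and \<open>N\<close> do not depend on the grid.\<close>

lemma eventually_grid_transition:
  assumes p: "cadlag_killed p" and u: "p 0 = Some u" "u \<in> C"
    and t: "0 < t" "p t \<in> Some ` B"
    and BC: "\<And>s. 0 < s \<Longrightarrow> s \<le> t \<Longrightarrow> p s \<in> Some ` (B \<union> C)"
  obtains T N where "\<forall>\<^sub>F m in sequentially. \<exists>n<T * Suc m. \<exists>v\<in>C. v \<le> N \<and>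
      p (grid m n) = Some v \<and> p (grid m (Suc n)) \<in> Some ` B"
proof -
  obtain y where y: "p t = Some y" "y \<in> B" using t by auto
  obtain N0 where N0: "\<And>s. 0 < s \<Longrightarrow> s \<le> t \<Longrightarrow> \<exists>v<N0. p s = Some v"
    using cadlag_killed_bounded_before[OF p _ y(1)] t(1) by force
  obtain e where e: "e > 0" "\<And>s. t \<le> s \<Longrightarrow> s < t + e \<Longrightarrow> p s = p t"
    using cadlag_killed_right_const[OF p, of t] t(1) by auto
  \<comment> \<open>The step may start at index \<open>0\<close>, where the state is
    \<open>u\<close> and \<open>N0\<close> says nothing; hence the maximum. \<open>T\<close> works
    because the first grid visit falls before \<open>t + 1\<close> and a unit of time holds
    \<open>m + 1\<close> steps.\<close>
  define N where "N = max N0 u"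
  define T where "T = nat \<lceil>t + 1\<rceil>"
  have "real T \<ge> t + 1" using t(1) unfolding T_def by linarith
  have "\<forall>\<^sub>F m in sequentially. \<exists>n\<ge>1. t < grid m n \<and> grid m n < t + min e 1"
    using t(1) e(1) by (intro eventually_grid_between) auto
  then have "\<forall>\<^sub>F m in sequentially. \<exists>n<T * Suc m. \<exists>v\<in>C. v \<le> N \<and>
      p (grid m n) = Some v \<and> p (grid m (Suc n)) \<in> Some ` B"
  proof eventually_elim
    case (elim m)
    then obtain n0 where n0: "t < grid m n0" "grid m n0 < t + min e 1" by auto
    then have *: "p (grid m n0) \<in> Some ` B" using e(2)[of "grid m n0"] t(2) by auto
    define k where "k = (LEAST k. 1 \<le> k \<and> p (grid m k) \<in> Some ` B)"
    have "1 \<le> n0" using n0(1) t(1) by (cases n0) auto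
    with * have **: "1 \<le> n0 \<and> p (grid m n0) \<in> Some ` B" by blast
    have k: "1 \<le> k \<and> p (grid m k) \<in> Some ` B"
      unfolding k_def by (rule LeastI[of _ n0], rule **)
    have "k \<le> n0"
      unfolding k_def by (rule Least_le, rule **)
    have least: "p (grid m i) \<notin> Some ` B" if "1 \<le> i" "i < k" for i
      using not_less_Least[of i "\<lambda>k. 1 \<le> k \<and> p (grid m k) \<in> Some ` B"] that unfolding k_def by auto
    obtain n where n: "k = Suc n" using k by (cases k) auto
    have "grid m k \<le> grid m n0" using \<open>k \<le> n0\<close> by simp
    then have "grid m k < real T" using n0 \<open>real T \<ge> t + 1\<close> by linarith
    then have "real k < real T * real (Suc m)" by (simp add: grid_def field_simps)
    then have "real k < real (T * Suc m)" by (simp only: of_nat_mult)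
    then have "k < T * Suc m" by (simp only: of_nat_less_iff)
    moreover have "\<exists>v\<in>C. v \<le> N \<and> p (grid m n) = Some v"
    proof (cases "n = 0")
      case True
      then show ?thesis using u by (intro bexI[of _ u]) (auto simp: N_def)
    next
      case False
      \<comment> \<open>Otherwise \<open>n\<close> would lie where the path still has its value at
        \<open>t\<close>, and would be an earlier grid visit to \<open>B\<close>.\<close>
      have "grid m n < t"
      proof (rule ccontr)
        assume "\<not> grid m n < t"
        moreover have "grid m n \<le> grid m n0" using \<open>k \<le> n0\<close> n by simp
        ultimately have "p (grid m n) = p t" using n0 by (intro e(2)) linarith+
        then show False using least[of n] False n t(2) by auto
      qed
      then have "p (grid m n) \<in> Some ` C" "\<exists>v<N0. p (grid m n) = Some v"
        using BC[of "grid m n"] N0[of "grid m n"] least[of n] False n by auto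
      then show ?thesis by (auto simp: N_def)
    qed
    ultimately show ?case using k n by (intro exI[of _ n]) auto
  qed
  then show ?thesis using that by blast
qed

section \<open>One-step equations of the skeleton\<close>

lemma ennreal_suminf_swap: "(\<Sum>i j. f i j) = (\<Sum>j i. f i j :: ennreal)" for f :: "nat \<Rightarrow> nat \<Rightarrow> ennreal"
proof -
  have "(\<Sum>i j. f i j) = (\<integral>\<^sup>+i. (\<Sum>j. f i j) \<partial>count_space UNIV)"
    by (rule nn_integral_count_space_nat[symmetric])
  also have "\<dots> = (\<Sum>j. \<integral>\<^sup>+i. f i j \<partial>count_space UNIV)"
    by (rule nn_integral_suminf) auto
  also have "\<dots> = (\<Sum>j i. f i j)"
    by (simp add: nn_integral_count_space_nat)
  finally show ?thesis .
qed

lemma ennreal_suminf_split_head: "(\<Sum>n. f n) = f 0 + (\<Sum>n. f (Suc n))" for f :: "nat \<Rightarrow> ennreal"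
proof -
  have "(\<lambda>n. f (Suc n)) sums (\<Sum>n. f (Suc n))" by (rule summable_sums) simp
  from sums_unique[OF sums_Suc[OF this]] show ?thesis by (simp add: add.commute)
qed

context markov_chain
begin

lemma space_P [simp]: "space (P x) = space M"
  by (rule sets_eq_imp_space_eq[OF sets_P])

lemma sets_P_iff [simp]: "A \<in> sets (P x) \<longleftrightarrow> A \<in> sets M"
  by (simp add: sets_P)

lemma measurable_P [simp]: "measurable (P x) N = measurable M N"
  by (rule measurable_cong_sets) (auto simp: sets_P)

lemma pred_X: "0 \<le> t \<Longrightarrow> Measurable.pred M (\<lambda>\<omega>. X \<omega> t \<in> B)"
  using measurable_sets[OF meas, of t B] by (simp add: pred_def vimage_def Int_def conj_commute)

lemma pred_X_eq: "0 \<le> t \<Longrightarrow> Measurable.pred M (\<lambda>\<omega>. X \<omega> t = y)"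
  using pred_X[of t "{y}"] by simp

lemma pred_skeleton_path: "Measurable.pred M (\<lambda>\<omega>. skeleton_path (X \<omega>) B m n x)"
  unfolding skeleton_path_def by (intro pred_intros_logic pred_intros_finite pred_X pred_X_eq) auto

lemma sets_skeleton_path [simp]: "{\<omega> \<in> space M. skeleton_path (X \<omega>) B m n x} \<in> sets M"
  using pred_skeleton_path by (simp add: pred_def)

lemma sigma_algebra_past: "sigma_algebra (space M) (past M X t)"
  unfolding past_def by (rule sigma_algebra_sigma_sets) auto

definition skeleton_prob :: "(nat \<Rightarrow> nat set) \<Rightarrow> nat \<Rightarrow> nat \<Rightarrow> nat \<Rightarrow> nat \<Rightarrow> ennreal" where
  "skeleton_prob B m n u w = emeasure (P u) {\<omega> \<in> space M. skeleton_path (X \<omega>) B m n w}"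

definition trans_prob :: "nat \<Rightarrow> nat \<Rightarrow> nat \<Rightarrow> real" where
  "trans_prob m u w = measure (P u) {\<omega> \<in> space M. X \<omega> (grid m 1) = Some w}"

lemma trans_prob_nonneg [simp]: "0 \<le> trans_prob m u w"
  by (simp add: trans_prob_def)

lemma emeasure_P: "emeasure (P u) A = ennreal (measure (P u) A)"
proof -
  interpret prob_space "P u" by (rule prob)
  show ?thesis by (rule emeasure_eq_measure)
qed

lemma skeleton_prob_1: "skeleton_prob B m (Suc 0) u w = ennreal (trans_prob m u w)"
  by (simp add: skeleton_prob_def trans_prob_def skeleton_path_def emeasure_P)

lemma skeleton_prob_cong:
  assumes "\<And>k. 1 \<le> k \<Longrightarrow> k < n \<Longrightarrow> B k = C k"
  shows "skeleton_prob B m n u w = skeleton_prob C m n u w"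
proof -
  have "skeleton_path p B m n w = skeleton_path p C m n w" for p
    using assms by (auto simp: skeleton_path_def)
  then show ?thesis by (simp add: skeleton_prob_def)
qed

text \<open>The last step is the one that the Markov assumption can split off, as it conditions on
  the past. It needs \<open>1 <= n\<close> because index \<open>0\<close> is unconstrained, so
  \<open>B 0\<close> has no counterpart on the left.\<close>

lemma skeleton_prob_Suc:
  assumes "1 \<le> n"
  shows "skeleton_prob B m (Suc n) u w =
    (\<Sum>v. if v \<in> B n then skeleton_prob B m n u v * ennreal (trans_prob m v w) else 0)"
proof -
  interpret past: sigma_algebra "space M" "past M X (grid m n)"
    by (rule sigma_algebra_past)
  define A where "A = {\<omega> \<in> space M. \<forall>k\<in>{1..<n}. X \<omega> (grid m k) \<in> Some ` B k}"
  have "{\<omega> \<in> space M. X \<omega> (grid m k) \<in> Some ` B k} \<in> past M X (grid m n)" if "k \<in> {1..<n}" for k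
    unfolding past_def
    by (intro sigma_sets.Basic CollectI exI[of _ "grid m k"] exI[of _ "Some ` B k"]) (use that in auto)
  then have A: "A \<in> past M X (grid m n)"
    unfolding A_def by (intro past.sets_Collect_finite_All) auto
  define E where "E v = (if v \<in> B n then A \<inter> {\<omega> \<in> space M. X \<omega> (grid m n) = Some v \<and>
      X \<omega> (grid m n + grid m 1) = Some w} else {})" for v
  have AE: "A \<inter> {\<omega> \<in> space M. X \<omega> (grid m n) = Some v} = {\<omega> \<in> space M. skeleton_path (X \<omega>) B m n v}" for v
    by (auto simp: A_def skeleton_path_def)
  have sets: "E v \<in> sets M" for v
  proof -
    have "{\<omega> \<in> space M. skeleton_path (X \<omega>) B m n v} \<inter> {\<omega> \<in> space M. X \<omega> (grid m n + grid m 1) = Some w} \<in> sets M"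
      using pred_X_eq[of "grid m n + grid m 1" "Some w"] by (intro sets.Int) (auto simp: pred_def)
    moreover have "{\<omega> \<in> space M. skeleton_path (X \<omega>) B m n v} \<inter> {\<omega> \<in> space M. X \<omega> (grid m n + grid m 1) = Some w} =
      A \<inter> {\<omega> \<in> space M. X \<omega> (grid m n) = Some v \<and> X \<omega> (grid m n + grid m 1) = Some w}"
      unfolding AE[symmetric] by auto
    ultimately show ?thesis by (simp add: E_def)
  qed
  have "{\<omega> \<in> space M. skeleton_path (X \<omega>) B m (Suc n) w} = (\<Union>v. E v)"
  proof (intro set_eqI iffI)
    fix \<omega> assume *: "\<omega> \<in> {\<omega> \<in> space M. skeleton_path (X \<omega>) B m (Suc n) w}"
    then obtain v where "v \<in> B n" "X \<omega> (grid m n) = Some v"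
      using assms by (auto simp: skeleton_path_def dest!: bspec[of _ _ n])
    then have "\<omega> \<in> E v"
      using * by (auto simp: E_def A_def skeleton_path_def grid_Suc[of m n])
    then show "\<omega> \<in> (\<Union>v. E v)" by auto
  next
    fix \<omega> assume "\<omega> \<in> (\<Union>v. E v)"
    then show "\<omega> \<in> {\<omega> \<in> space M. skeleton_path (X \<omega>) B m (Suc n) w}"
      by (auto simp: E_def A_def skeleton_path_def grid_Suc[of m n] less_Suc_eq split: if_splits)
  qed
  then have "skeleton_prob B m (Suc n) u w = emeasure (P u) (\<Union>v. E v)"
    by (simp add: skeleton_prob_def)
  also have "\<dots> = (\<Sum>v. emeasure (P u) (E v))"
  proof (rule suminf_emeasure[symmetric])
    show "range E \<subseteq> sets (P u)" using sets by auto
    show "disjoint_family E" by (auto simp: disjoint_family_on_def E_def split: if_splits)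
  qed
  also have "\<dots> = (\<Sum>v. if v \<in> B n then skeleton_prob B m n u v * ennreal (trans_prob m v w) else 0)"
  proof (rule suminf_cong)
    fix v
    show "emeasure (P u) (E v) = (if v \<in> B n then skeleton_prob B m n u v * ennreal (trans_prob m v w) else 0)"
      using markov[OF _ _ A, of "grid m 1" u v w]
      by (simp add: E_def emeasure_P skeleton_prob_def AE trans_prob_def ennreal_mult)
  qed
  finally show ?thesis .
qed

text \<open>Splitting at the first step directly would take a Markov property for events of the
  whole future; induction obtains it from the last-step form by exchanging two sums. The sets shift
  because the clock restarts.\<close>

lemma skeleton_prob_first_step:
  "skeleton_prob B m (Suc (Suc n)) u w =
    (\<Sum>v. if v \<in> B (Suc 0) then ennreal (trans_prob m u v) * skeleton_prob (\<lambda>k. B (Suc k)) m (Suc n) v w else 0)"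
proof (induction n arbitrary: w)
  case 0
  show ?case
    by (subst skeleton_prob_Suc) (simp_all add: skeleton_prob_1 cong: if_cong)
next
  case (Suc n)
  let ?t = "\<lambda>u v. ennreal (trans_prob m u v)" and ?B = "\<lambda>k. B (Suc k)"
  have "skeleton_prob B m (Suc (Suc (Suc n))) u w =
    (\<Sum>v. if v \<in> B (Suc (Suc n)) then (\<Sum>y. if y \<in> B (Suc 0)
       then ?t u y * skeleton_prob ?B m (Suc n) y v else 0) * ?t v w else 0)"
    by (subst skeleton_prob_Suc) (simp_all add: Suc.IH cong: if_cong)
  also have "\<dots> = (\<Sum>v y. if v \<in> B (Suc (Suc n)) \<and> y \<in> B (Suc 0)
      then ?t u y * (skeleton_prob ?B m (Suc n) y v * ?t v w) else 0)"
    by (intro suminf_cong) (auto simp: mult.assoc simp flip: ennreal_suminf_multc intro!: suminf_cong)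
  also have "\<dots> = (\<Sum>y v. if v \<in> B (Suc (Suc n)) \<and> y \<in> B (Suc 0)
      then ?t u y * (skeleton_prob ?B m (Suc n) y v * ?t v w) else 0)"
    by (rule ennreal_suminf_swap)
  also have "\<dots> = (\<Sum>y. if y \<in> B (Suc 0) then ?t u y *
      (\<Sum>v. if v \<in> B (Suc (Suc n)) then skeleton_prob ?B m (Suc n) y v * ?t v w else 0) else 0)"
    by (intro suminf_cong) (auto simp: ennreal_suminf_cmult[symmetric] simp del: ennreal_suminf_cmult intro!: suminf_cong)
  also have "\<dots> = (\<Sum>y. if y \<in> B (Suc 0) then ?t u y * skeleton_prob ?B m (Suc (Suc n)) y w else 0)"
    by (subst (2) skeleton_prob_Suc) simp_all
  finally show ?case .
qed

definition skeleton_hit_value :: "real \<Rightarrow> nat \<Rightarrow> nat \<Rightarrow> nat \<Rightarrow> nat \<Rightarrow> ennreal" where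
  "skeleton_hit_value q x z m u = (\<integral>\<^sup>+\<omega>. skeleton_hit_weight q x z m (X \<omega>) \<partial>P u)"

lemma measurable_skeleton_if:
  "(\<lambda>\<omega>. if skeleton_path (X \<omega>) B m n x then c else (0::ennreal)) \<in> borel_measurable M"
  by (rule measurable_If) (auto intro: pred_skeleton_path)

lemma nn_integral_skeleton_if:
  "(\<integral>\<^sup>+\<omega>. (if skeleton_path (X \<omega>) B m n x then c else 0) \<partial>P u) = c * skeleton_prob B m n u x"
proof -
  have "(\<integral>\<^sup>+\<omega>. (if skeleton_path (X \<omega>) B m n x then c else 0) \<partial>P u) =
    (\<integral>\<^sup>+\<omega>. c * indicator {\<omega> \<in> space M. skeleton_path (X \<omega>) B m n x} \<omega> \<partial>P u)"
    by (intro nn_integral_cong) (auto simp: indicator_def)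
  also have "\<dots> = c * skeleton_prob B m n u x"
    by (simp add: nn_integral_cmult_indicator skeleton_prob_def)
  finally show ?thesis .
qed

lemma measurable_skeleton_hit_weight: "(\<lambda>\<omega>. skeleton_hit_weight q x z m (X \<omega>)) \<in> borel_measurable M"
  unfolding skeleton_hit_weight_def by (intro borel_measurable_suminf_order measurable_skeleton_if)

lemma measurable_skeleton_excursion_weight:
  "(\<lambda>\<omega>. skeleton_excursion_weight q x z m (X \<omega>)) \<in> borel_measurable M"
  unfolding skeleton_excursion_weight_def
  by (intro borel_measurable_suminf_order measurable_skeleton_if)

lemma skeleton_hit_value_eq:
  "skeleton_hit_value q x z m u =
    (\<Sum>n. ennreal (exp (- q * grid m (Suc n))) * skeleton_prob (\<lambda>_. - {x, z}) m (Suc n) u x)"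
  unfolding skeleton_hit_value_def skeleton_hit_weight_def
  by (subst nn_integral_suminf) (auto simp: nn_integral_skeleton_if intro!: measurable_skeleton_if)

lemma skeleton_hit_value_le_1:
  assumes "0 \<le> q"
  shows "skeleton_hit_value q x z m u \<le> 1"
proof -
  interpret prob_space "P u" by (rule prob)
  have "skeleton_hit_value q x z m u \<le> (\<integral>\<^sup>+\<omega>. 1 \<partial>P u)"
    unfolding skeleton_hit_value_def by (intro nn_integral_mono skeleton_hit_weight_le_1 assms)
  then show ?thesis using emeasure_space_1 by simp
qed

text \<open>The exponential factor undoes the discount of the first step, which ends at
  \<open>x\<close>, is lost at \<open>z\<close>, or restarts from \<open>v\<close>.\<close>

lemma skeleton_hit_value_one_step:
  assumes "x \<noteq> z"
  shows "ennreal (exp (q * grid m 1)) * skeleton_hit_value q x z m u =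
    (\<Sum>v. ennreal (trans_prob m u v) *
       (if v = x then 1 else if v = z then 0 else skeleton_hit_value q x z m v))"
proof -
  let ?e = "\<lambda>n. ennreal (exp (- q * grid m n))" and ?B = "\<lambda>_::nat. - {x, z}"
  let ?t = "\<lambda>u v. ennreal (trans_prob m u v)"
  have e: "ennreal (exp (q * grid m 1)) * ?e (Suc n) = ?e n" for n
    by (simp add: ennreal_mult[symmetric] grid_Suc[of m n] exp_add[symmetric] algebra_simps)
  have "ennreal (exp (q * grid m 1)) * skeleton_hit_value q x z m u =
     (\<Sum>n. ?e n * skeleton_prob ?B m (Suc n) u x)"
    unfolding skeleton_hit_value_eq ennreal_suminf_cmult[symmetric] by (simp add: mult.assoc[symmetric] e[simplified])
  also have "\<dots> = ?t u x + (\<Sum>n. ?e (Suc n) * skeleton_prob ?B m (Suc (Suc n)) u x)"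
    by (subst ennreal_suminf_split_head) (simp add: skeleton_prob_1)
  also have "(\<Sum>n. ?e (Suc n) * skeleton_prob ?B m (Suc (Suc n)) u x) =
     (\<Sum>n v. if v \<in> - {x, z} then ?t u v * (?e (Suc n) * skeleton_prob ?B m (Suc n) v x) else 0)"
    unfolding skeleton_prob_first_step
    by (intro suminf_cong)
       (auto simp: ennreal_suminf_cmult[symmetric] mult_ac simp del: ennreal_suminf_cmult intro!: suminf_cong)
  also have "\<dots> = (\<Sum>v n. if v \<in> - {x, z} then ?t u v * (?e (Suc n) * skeleton_prob ?B m (Suc n) v x) else 0)"
    by (rule ennreal_suminf_swap)
  also have "\<dots> = (\<Sum>v. if v \<in> - {x, z} then ?t u v * skeleton_hit_value q x z m v else 0)"
    unfolding skeleton_hit_value_eq by (intro suminf_cong) auto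
  also have "?t u x = (\<Sum>v. if v = x then ?t u v else 0)"
    by (subst suminf_single[of x]) auto
  also have "(\<Sum>v. if v = x then ?t u v else 0) +
      (\<Sum>v. if v \<in> - {x, z} then ?t u v * skeleton_hit_value q x z m v else 0) =
      (\<Sum>v. (if v = x then ?t u v else 0) +
        (if v \<in> - {x, z} then ?t u v * skeleton_hit_value q x z m v else 0))"
    by (rule suminf_add) auto
  also have "\<dots> = (\<Sum>v. ?t u v * (if v = x then 1 else if v = z then 0 else skeleton_hit_value q x z m v))"
    by (intro suminf_cong) (use assms in auto)
  finally show ?thesis .
qed

lemma skeleton_prob_excursion:
  "skeleton_prob (excursion_sets x z j) m (Suc (j + n)) z x =
    ennreal (trans_prob m z z) ^ j * skeleton_prob (\<lambda>_. - {x, z}) m (Suc n) z x"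
proof (induction j)
  case 0
  show ?case by (simp, rule skeleton_prob_cong) (auto simp: excursion_sets_def)
next
  case (Suc j)
  have "skeleton_prob (excursion_sets x z (Suc j)) m (Suc (Suc (j + n))) z x =
    ennreal (trans_prob m z z) * skeleton_prob (excursion_sets x z j) m (Suc (j + n)) z x"
    unfolding skeleton_prob_first_step
    by (subst suminf_single[of z]) (auto simp: excursion_sets_def intro!: arg_cong2[where f = "(*)"] skeleton_prob_cong)
  then show ?case by (simp add: Suc.IH mult.assoc)
qed

text \<open>Waiting at \<open>z\<close> produces the geometric series. The exponential factor
  removes one step: the hitting value counts the step leaving \<open>z\<close>, whereas excursions
  are timed from the first point off \<open>z\<close>.\<close>

lemma nn_integral_skeleton_excursion_weight:
  "(\<integral>\<^sup>+\<omega>. skeleton_excursion_weight q x z m (X \<omega>) \<partial>P z) =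
    (\<Sum>j. ennreal (trans_prob m z z) ^ j) * (ennreal (exp (q * grid m 1)) * skeleton_hit_value q x z m z)"
proof -
  let ?e = "\<lambda>n. ennreal (exp (- q * grid m n))" and ?B = "\<lambda>_::nat. - {x, z}"
  have e: "ennreal (exp (q * grid m 1)) * ?e (Suc n) = ?e n" for n
    by (simp add: ennreal_mult[symmetric] grid_Suc[of m n] exp_add[symmetric] algebra_simps)
  have "(\<integral>\<^sup>+\<omega>. skeleton_excursion_weight q x z m (X \<omega>) \<partial>P z) =
     (\<Sum>j n. ?e n * skeleton_prob (excursion_sets x z j) m (Suc (j + n)) z x)"
    unfolding skeleton_excursion_weight_def
    by (simp add: nn_integral_suminf borel_measurable_suminf_order measurable_skeleton_if nn_integral_skeleton_if)
  also have "\<dots> = (\<Sum>j n. ennreal (trans_prob m z z) ^ j * (?e n * skeleton_prob ?B m (Suc n) z x))"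
    by (intro suminf_cong) (simp add: skeleton_prob_excursion mult.left_commute)
  also have "\<dots> = (\<Sum>j. ennreal (trans_prob m z z) ^ j) * (\<Sum>n. ?e n * skeleton_prob ?B m (Suc n) z x)"
    by simp
  also have "(\<Sum>n. ?e n * skeleton_prob ?B m (Suc n) z x) =
      ennreal (exp (q * grid m 1)) * skeleton_hit_value q x z m z"
    unfolding skeleton_hit_value_eq ennreal_suminf_cmult[symmetric] by (simp add: mult.assoc[symmetric] e[simplified])
  finally show ?thesis .
qed

text \<open>Right continuity lets the witnessing time be rational, which leaves a countable
  union.\<close>

lemma measurable_entry_time:
  assumes f: "f \<in> borel_measurable M" "\<And>\<omega>. \<omega> \<in> space M \<Longrightarrow> 0 \<le> f \<omega>"
  shows "(\<lambda>\<omega>. entry_time (f \<omega>) A (X \<omega>)) \<in> borel_measurable M"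
proof (rule borel_measurableI_less)
  fix c :: ereal
  have "{\<omega> \<in> space M. entry_time (f \<omega>) A (X \<omega>) < c} =
    {\<omega> \<in> space M. \<exists>r\<in>\<rat> \<inter> {0..}. f \<omega> < ereal r \<and> ereal r < c \<and> X \<omega> r \<in> Some ` A}"
  proof (intro Collect_cong conj_cong refl iffI)
    fix \<omega> assume \<omega>: "\<omega> \<in> space M" and "entry_time (f \<omega>) A (X \<omega>) < c"
    then obtain t where t: "f \<omega> < ereal t" "ereal t < c" "X \<omega> t \<in> Some ` A"
      unfolding entry_time_less_iff by auto
    have "0 < ereal t" using f(2)[OF \<omega>] t(1) by (rule le_less_trans)
    then have "0 < t" by simp
    obtain e where e: "e > 0" "\<And>s. t \<le> s \<Longrightarrow> s < t + e \<Longrightarrow> X \<omega> s = X \<omega> t"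
      using cadlag_killed_right_const[OF paths[OF \<omega>], of t] \<open>0 < t\<close> by auto
    obtain d where d: "ereal t < ereal d" "ereal d < c"
      using ereal_dense2[OF t(2)] by auto
    have "t < min d (t + e)" using d e by auto
    then obtain r where r: "r \<in> \<rat>" "t < r" "r < min d (t + e)"
      using Rats_dense_in_real by blast
    have "f \<omega> < ereal r" using t(1) r(2) by (meson less_ereal.simps(1) less_trans)
    moreover have "ereal r < c" using r(3) d(2) by (meson less_ereal.simps(1) less_trans min_less_iff_conj)
    moreover have "X \<omega> r = X \<omega> t" by (rule e(2)) (use r in auto)
    ultimately show "\<exists>r\<in>\<rat> \<inter> {0..}. f \<omega> < ereal r \<and> ereal r < c \<and> X \<omega> r \<in> Some ` A"
      using r t(3) \<open>0 < t\<close> by (intro bexI[of _ r]) auto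
  next
    fix \<omega> assume "\<exists>r\<in>\<rat> \<inter> {0..}. f \<omega> < ereal r \<and> ereal r < c \<and> X \<omega> r \<in> Some ` A"
    then show "entry_time (f \<omega>) A (X \<omega>) < c" unfolding entry_time_less_iff by auto
  qed
  also have "\<dots> \<in> sets M"
  proof -
    have "countable (\<rat> \<inter> {0..} :: real set)" by (intro countable_Int1 countable_rat)
    moreover have "Measurable.pred M (\<lambda>\<omega>. f \<omega> < ereal r \<and> ereal r < c \<and> X \<omega> r \<in> Some ` A)"
      if "r \<in> \<rat> \<inter> {0..}" for r
      using f(1) that by (intro pred_intros_logic pred_X) (auto simp: pred_def)
    ultimately show ?thesis
      by (intro sets.sets_Collect_countable_Ex') (auto simp: pred_def)
  qed
  finally show "{\<omega> \<in> space M. entry_time (f \<omega>) A (X \<omega>) < c} \<in> sets M" .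
qed

lemma measurable_hit_time [measurable]: "(\<lambda>\<omega>. hit_time A (X \<omega>)) \<in> borel_measurable M"
  unfolding hit_time_eq_entry_time by (rule measurable_entry_time) auto

lemma measurable_exit_time [measurable]: "(\<lambda>\<omega>. exit_time z (X \<omega>)) \<in> borel_measurable M"
  unfolding exit_time_def by (rule measurable_hit_time)

lemma measurable_return_time [measurable]: "(\<lambda>\<omega>. return_time z (X \<omega>)) \<in> borel_measurable M"
  unfolding return_time_eq_entry_time
  by (rule measurable_entry_time) (auto simp: exit_time_def hit_time_nonneg)

lemma measurable_hit_weight [measurable]: "(\<lambda>\<omega>. hit_weight q x z (X \<omega>)) \<in> borel_measurable M"
  unfolding hit_weight_def by measurable

lemma measurable_excursion_weight [measurable]: "(\<lambda>\<omega>. excursion_weight q x z (X \<omega>)) \<in> borel_measurable M"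
  unfolding excursion_weight_def by measurable

section \<open>Limits of the skeleton values\<close>

definition hit_value :: "real \<Rightarrow> nat \<Rightarrow> nat \<Rightarrow> nat \<Rightarrow> real" where
  "hit_value q x z u = enn2real (\<integral>\<^sup>+\<omega>. ennreal (hit_weight q x z (X \<omega>)) \<partial>P u)"

lemma nn_integral_limit_bounded:
  assumes f: "\<And>m. f m \<in> borel_measurable M" "\<And>m \<omega>. f m \<omega> \<le> (1::ennreal)"
    and lim: "\<And>\<omega>. \<omega> \<in> space M \<Longrightarrow> (\<lambda>m. f m \<omega>) \<longlonglongrightarrow> g \<omega>" and g: "g \<in> borel_measurable M"
  shows "(\<lambda>m. \<integral>\<^sup>+\<omega>. f m \<omega> \<partial>P u) \<longlonglongrightarrow> (\<integral>\<^sup>+\<omega>. g \<omega> \<partial>P u)"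
    and "(\<lambda>m. enn2real (\<integral>\<^sup>+\<omega>. f m \<omega> \<partial>P u)) \<longlonglongrightarrow> enn2real (\<integral>\<^sup>+\<omega>. g \<omega> \<partial>P u)"
proof -
  interpret prob_space "P u" by (rule prob)
  show 1: "(\<lambda>m. \<integral>\<^sup>+\<omega>. f m \<omega> \<partial>P u) \<longlonglongrightarrow> (\<integral>\<^sup>+\<omega>. g \<omega> \<partial>P u)"
    by (rule nn_integral_dominated_convergence[where w = "\<lambda>_. 1"])
       (use assms emeasure_space_1 in auto)
  have "(\<integral>\<^sup>+\<omega>. f m \<omega> \<partial>P u) \<le> (\<integral>\<^sup>+\<omega>. 1 \<partial>P u)" for m
    by (intro nn_integral_mono f)
  then have le: "(\<integral>\<^sup>+\<omega>. f m \<omega> \<partial>P u) \<le> 1" for m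
    using emeasure_space_1 by simp
  have "(\<integral>\<^sup>+\<omega>. g \<omega> \<partial>P u) \<le> 1"
    by (rule LIMSEQ_le_const2[OF 1]) (use le in auto)
  then have "(\<integral>\<^sup>+\<omega>. g \<omega> \<partial>P u) \<noteq> \<infinity>" by (auto simp: top_unique)
  then show "(\<lambda>m. enn2real (\<integral>\<^sup>+\<omega>. f m \<omega> \<partial>P u)) \<longlonglongrightarrow> enn2real (\<integral>\<^sup>+\<omega>. g \<omega> \<partial>P u)"
    using 1 by (intro tendsto_enn2real) (auto simp: less_top)
qed

lemma tendsto_hit_value:
  assumes "0 \<le> q" "x \<noteq> z"
  shows "(\<lambda>m. enn2real (skeleton_hit_value q x z m u)) \<longlonglongrightarrow> hit_value q x z u"
  unfolding hit_value_def skeleton_hit_value_def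
  by (rule nn_integral_limit_bounded)
     (use assms paths in \<open>auto intro!: measurable_skeleton_hit_weight skeleton_hit_weight_le_1
        tendsto_skeleton_hit_weight\<close>)

lemma tendsto_excursion_value:
  assumes "0 \<le> q" "x \<noteq> z"
  shows "(\<lambda>m. enn2real (\<integral>\<^sup>+\<omega>. skeleton_excursion_weight q x z m (X \<omega>) \<partial>P z))
    \<longlonglongrightarrow> enn2real (\<integral>\<^sup>+\<omega>. ennreal (excursion_weight q x z (X \<omega>)) \<partial>P z)"
  by (rule nn_integral_limit_bounded)
     (use assms paths in \<open>auto intro!: measurable_skeleton_excursion_weight skeleton_excursion_weight_le_1
        tendsto_skeleton_excursion_weight\<close>)

lemma excursion_laplace_eq:
  "excursion_laplace P X Q q x z =
    - Q z z * enn2real (\<integral>\<^sup>+\<omega>. ennreal (excursion_weight q x z (X \<omega>)) \<partial>P z)"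
proof -
  have "(\<integral>\<omega>. exp (- q * real_of_ereal (hit_time {x} (X \<omega>) - exit_time z (X \<omega>))) *
          indicator {\<omega>. hit_time {x} (X \<omega>) < return_time z (X \<omega>)} \<omega> \<partial>P z) =
        (\<integral>\<omega>. excursion_weight q x z (X \<omega>) \<partial>P z)"
    by (intro Bochner_Integration.integral_cong) (auto simp: excursion_weight_def)
  also have "\<dots> = enn2real (\<integral>\<^sup>+\<omega>. ennreal (excursion_weight q x z (X \<omega>)) \<partial>P z)"
    by (intro integral_eq_nn_integral) (auto simp: excursion_weight_def)
  finally show ?thesis by (simp add: excursion_laplace_def)
qed

end

section \<open>The limit of the one-step equations\<close>

text \<open>Mass cannot escape to infinity because the total masses \<open>b m\<close> converge to the mass of the
  limit.\<close>

lemma tendsto_suminf_mult_bounded: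
  fixes a g :: "nat \<Rightarrow> nat \<Rightarrow> real"
  assumes a: "\<And>m v. 0 \<le> a m v" "\<And>m. summable (a m)" "\<And>v. (\<lambda>m. a m v) \<longlonglongrightarrow> A v"
    and b: "\<And>m. suminf (a m) \<le> b m" "b \<longlonglongrightarrow> B" "A sums B"
    and g: "\<And>m v. \<bar>g m v\<bar> \<le> 1" "\<And>v. (\<lambda>m. g m v) \<longlonglongrightarrow> G v"
  shows "(\<lambda>m. \<Sum>v. a m v * g m v) \<longlonglongrightarrow> (\<Sum>v. A v * G v)"
proof (rule LIMSEQ_I)
  fix e :: real assume "e > 0"
  have A0: "0 \<le> A v" for v
    by (rule LIMSEQ_le_const[OF a(3)]) (use a(1) in auto)
  have G1: "\<bar>G v\<bar> \<le> 1" for v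
    by (rule LIMSEQ_le_const2[OF tendsto_rabs[OF g(2)]]) (use g(1) in auto)
  have split: "\<bar>(\<Sum>v. c v * h v) - (\<Sum>v<N. c v * h v)\<bar> \<le> suminf c - (\<Sum>v<N. c v)"
    if c: "\<And>v. 0 \<le> c v" "summable c" and h: "\<And>v. \<bar>h v\<bar> \<le> 1" for c h :: "nat \<Rightarrow> real" and N
  proof -
    have le: "\<bar>c v * h v\<bar> \<le> c v" for v
      using mult_left_mono[OF h c(1), of v v] c(1)[of v] by (simp add: abs_mult)
    have "summable (\<lambda>v. c v * h v)"
      by (rule summable_comparison_test'[OF c(2), of 0]) (use le in auto)
    then have "(\<Sum>v. c v * h v) - (\<Sum>v<N. c v * h v) = (\<Sum>v. c (v + N) * h (v + N))"
      by (rule suminf_minus_initial_segment[symmetric])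
    also have "\<bar>\<dots>\<bar> \<le> (\<Sum>v. c (v + N))"
    proof -
      have s: "summable (\<lambda>v. c (v + N))" by (rule summable_ignore_initial_segment[OF c(2)])
      have s': "summable (\<lambda>v. \<bar>c (v + N) * h (v + N)\<bar>)"
        by (rule summable_comparison_test'[OF s, of 0]) (use le in auto)
      have "\<bar>\<Sum>v. c (v + N) * h (v + N)\<bar> \<le> (\<Sum>v. \<bar>c (v + N) * h (v + N)\<bar>)"
        by (rule summable_rabs[OF s'])
      also have "\<dots> \<le> (\<Sum>v. c (v + N))"
        by (rule suminf_le[OF le s' s])
      finally show ?thesis .
    qed
    also have "\<dots> = suminf c - (\<Sum>v<N. c v)"
      by (rule suminf_minus_initial_segment[OF c(2)])
    finally show ?thesis .
  qed
  have "(\<lambda>N. \<Sum>v<N. A v) \<longlonglongrightarrow> B" using b(3) by (simp add: sums_def)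
  then have "\<forall>\<^sub>F N in sequentially. (\<Sum>v<N. A v) > B - e / 2"
    by (rule order_tendstoD) (use \<open>e > 0\<close> in auto)
  then obtain N where "B - e / 2 < (\<Sum>v<N. A v)"
    by (auto simp: eventually_sequentially)
  then have N: "B - (\<Sum>v<N. A v) < e / 2" by simp
  \<comment> \<open>Bounds the error by a finite head and two tails. The tail of \<open>a m\<close>
    is measured against \<open>b m\<close>, which may exceed the sum; in the limit both tails are
    \<open>B\<close> minus the head of \<open>A\<close>, hence below \<open>e / 2\<close>.\<close>
  let ?U = "\<lambda>m. \<bar>(\<Sum>v<N. a m v * g m v) - (\<Sum>v<N. A v * G v)\<bar> + (b m - (\<Sum>v<N. a m v)) + (B - (\<Sum>v<N. A v))"
  have "?U \<longlonglongrightarrow> \<bar>(\<Sum>v<N. A v * G v) - (\<Sum>v<N. A v * G v)\<bar> + (B - (\<Sum>v<N. A v)) + (B - (\<Sum>v<N. A v))"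
    by (intro tendsto_intros a g b)
  then have "\<forall>\<^sub>F m in sequentially. ?U m < e"
    by (rule order_tendstoD) (use N in auto)
  then obtain m0 where m0: "\<And>m. m \<ge> m0 \<Longrightarrow> ?U m < e"
    by (auto simp: eventually_sequentially)
  show "\<exists>no. \<forall>m\<ge>no. norm ((\<Sum>v. a m v * g m v) - (\<Sum>v. A v * G v)) < e"
  proof (intro exI allI impI)
    fix m assume "m0 \<le> m"
    have "suminf A = B" "summable A" using b(3) by (auto simp: sums_iff)
    then have "\<bar>(\<Sum>v. A v * G v) - (\<Sum>v<N. A v * G v)\<bar> \<le> B - (\<Sum>v<N. A v)"
      using split[of A G N] A0 G1 by simp
    moreover have "\<bar>(\<Sum>v. a m v * g m v) - (\<Sum>v<N. a m v * g m v)\<bar> \<le> b m - (\<Sum>v<N. a m v)"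
      using split[of "a m" "g m" N] a(1,2) g(1) b(1)[of m] by auto
    ultimately show "norm ((\<Sum>v. a m v * g m v) - (\<Sum>v. A v * G v)) < e"
      using m0[OF \<open>m0 \<le> m\<close>] unfolding real_norm_def by linarith
  qed
qed

lemma filterlim_grid_at_right: "filterlim (\<lambda>m. grid m 1) (at_right 0) sequentially"
proof (rule tendsto_imp_filterlim_at_right)
  show "(\<lambda>m. grid m 1) \<longlonglongrightarrow> 0"
    using LIMSEQ_inverse_real_of_nat by (simp add: grid_def inverse_eq_divide)
qed (simp del: One_nat_def)

lemma tendsto_exp_grid_quotient: "(\<lambda>m. (exp (q * grid m 1) - 1) / grid m 1) \<longlonglongrightarrow> q"
proof -
  have "((\<lambda>h. exp (q * h)) has_real_derivative q) (at 0)"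
    by (auto intro!: derivative_eq_intros)
  then have "((\<lambda>h. (exp (q * h) - 1) / h) \<longlongrightarrow> q) (at 0)"
    by (simp add: DERIV_def)
  then have "((\<lambda>h. (exp (q * h) - 1) / h) \<longlongrightarrow> q) (at_right 0)"
    by (rule filterlim_mono) (auto intro: at_le)
  then show ?thesis by (rule filterlim_compose[OF _ filterlim_grid_at_right])
qed

text \<open>Skeleton hitting starts at index \<open>1\<close>, so its value at \<open>x\<close> or
  \<open>z\<close> concerns a later visit, while the one-step equation needs \<open>1\<close> and
  \<open>0\<close> there. The uncorrected value at \<open>z\<close> is not overwritten, since it
  carries the excursions.\<close>

definition with_boundary :: "nat \<Rightarrow> nat \<Rightarrow> (nat \<Rightarrow> real) \<Rightarrow> nat \<Rightarrow> real" where
  "with_boundary x z h v = (if v = x then 1 else if v = z then 0 else h v)"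

context markov_chain
begin

lemma tendsto_rate:
  "(\<lambda>m. (trans_prob m u v - (if u = v then 1 else 0)) / grid m 1) \<longlonglongrightarrow> Q u v"
  unfolding trans_prob_def by (rule filterlim_compose[OF Q_matrix filterlim_grid_at_right])

lemma Q_nonneg: "u \<noteq> v \<Longrightarrow> 0 \<le> Q u v"
  by (rule LIMSEQ_le_const[OF tendsto_rate]) auto

lemma trans_prob_summable: "summable (trans_prob m u)"
  and suminf_trans_prob_le_1: "suminf (trans_prob m u) \<le> 1"
proof -
  interpret prob_space "P u" by (rule prob)
  have "trans_prob m u sums measure (P u) (\<Union>v. {\<omega> \<in> space M. X \<omega> (grid m 1) = Some v})"
    unfolding trans_prob_def
    by (rule finite_measure_UNION)
       (use pred_X_eq[of "grid m 1"] in \<open>auto simp: disjoint_family_on_def pred_def\<close>)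
  then show "summable (trans_prob m u)" "suminf (trans_prob m u) \<le> 1"
    by (auto simp: sums_iff)
qed

text \<open>The off-diagonal part of the difference quotient of the transition matrix; the entry at
  \<open>u\<close>, divided by the mesh, would diverge.\<close>

definition exit_rate :: "nat \<Rightarrow> nat \<Rightarrow> nat \<Rightarrow> real" where
  "exit_rate m u v = (if v = u then 0 else trans_prob m u v / grid m 1)"

lemma exit_rate_sums:
  "exit_rate m u sums ((suminf (trans_prob m u) - trans_prob m u u) / grid m 1)"
proof -
  have "(\<lambda>v. (trans_prob m u v - (if v = u then trans_prob m u v else 0)) / grid m 1) sums
     ((suminf (trans_prob m u) - trans_prob m u u) / grid m 1)"
    by (intro sums_divide sums_diff sums_single summable_sums trans_prob_summable)
  moreover have "(\<lambda>v. (trans_prob m u v - (if v = u then trans_prob m u v else 0)) / grid m 1) = exit_rate m u"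
    by (auto simp: exit_rate_def fun_eq_iff)
  ultimately show ?thesis by simp
qed

lemma tendsto_exit_rate: "(\<lambda>m. exit_rate m u v) \<longlonglongrightarrow> (if v = u then 0 else Q u v)"
  using tendsto_rate[of u v] by (auto simp: exit_rate_def cong: if_cong)

lemma tendsto_total_exit_rate: "(\<lambda>m. (1 - trans_prob m u u) / grid m 1) \<longlonglongrightarrow> - Q u u"
  using tendsto_minus[OF tendsto_rate[of u u]] by (simp add: minus_divide_left)

lemma Q_off_diagonal_sums: "(\<lambda>v. if v = u then 0 else Q u v) sums (- Q u u)"
proof -
  have "(\<lambda>v. Q u v - (if v = u then Q u v else 0)) sums (0 - Q u u)"
    by (intro sums_diff sums_single conservative)
  moreover have "(\<lambda>v. Q u v - (if v = u then Q u v else 0)) = (\<lambda>v. if v = u then 0 else Q u v)"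
    by auto
  ultimately show ?thesis by simp
qed

text \<open>Here conservativity prevents a loss in the limit: the total rate of the skeleton is only
  bounded by \<open>(1 - trans_prob m u u) / grid m 1\<close>, but this bound tends to
  \<open>- Q u u\<close>, the full sum of the limiting rates.\<close>

lemma tendsto_exit_rate_sum:
  assumes "\<And>m v. \<bar>g m v\<bar> \<le> 1" "\<And>v. (\<lambda>m. g m v) \<longlonglongrightarrow> G v"
  shows "(\<lambda>m. \<Sum>v. exit_rate m u v * g m v) \<longlonglongrightarrow> (\<Sum>v. (if v = u then 0 else Q u v) * G v)"
proof (rule tendsto_suminf_mult_bounded[OF _ _ tendsto_exit_rate _ tendsto_total_exit_rate Q_off_diagonal_sums assms])
  show "0 \<le> exit_rate m u v" for m v by (simp add: exit_rate_def)
  show "summable (exit_rate m u)" for m using exit_rate_sums by (simp add: sums_iff)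
  show "suminf (exit_rate m u) \<le> (1 - trans_prob m u u) / grid m 1" for m
    using exit_rate_sums[of m u] suminf_trans_prob_le_1[of m u]
    by (auto simp: sums_iff intro!: divide_right_mono simp del: One_nat_def)
qed

context
  fixes q :: real and x z :: nat
  assumes q: "0 \<le> q" and xz: "x \<noteq> z"
begin

lemma enn2real_skeleton_hit_value:
  "ennreal (enn2real (skeleton_hit_value q x z m u)) = skeleton_hit_value q x z m u"
  "enn2real (skeleton_hit_value q x z m u) \<le> 1"
proof -
  have "skeleton_hit_value q x z m u \<le> 1" by (rule skeleton_hit_value_le_1[OF q])
  then show "ennreal (enn2real (skeleton_hit_value q x z m u)) = skeleton_hit_value q x z m u"
    by (intro ennreal_enn2real) (auto simp: less_top[symmetric] top_unique)
  show "enn2real (skeleton_hit_value q x z m u) \<le> 1"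
    using enn2real_mono[OF \<open>_ \<le> 1\<close>] by simp
qed

abbreviation (input) skel :: "nat \<Rightarrow> nat \<Rightarrow> real" where
  "skel m \<equiv> with_boundary x z (\<lambda>v. enn2real (skeleton_hit_value q x z m v))"

abbreviation (input) limit_value :: "nat \<Rightarrow> real" where
  "limit_value \<equiv> with_boundary x z (hit_value q x z)"

lemma skel_bounds: "0 \<le> skel m v" "skel m v \<le> 1"
  using enn2real_skeleton_hit_value(2) by (auto simp: with_boundary_def)

lemma tendsto_skel: "(\<lambda>m. skel m v) \<longlonglongrightarrow> limit_value v"
  using tendsto_hit_value[OF q xz, of v] by (auto simp: with_boundary_def)

lemma skeleton_one_step_real:
  "exp (q * grid m 1) * enn2real (skeleton_hit_value q x z m u) =
    trans_prob m u u * skel m u + grid m 1 * (\<Sum>v. exit_rate m u v * skel m v)"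
proof -
  let ?h = "\<lambda>v. enn2real (skeleton_hit_value q x z m v)"
  have le: "norm (trans_prob m u v * skel m v) \<le> trans_prob m u v" for v
    using mult_left_mono[OF skel_bounds(2), of "trans_prob m u v"] skel_bounds(1)[of m v]
    by (simp add: abs_mult)
  have sm: "summable (\<lambda>v. trans_prob m u v * skel m v)"
    by (rule summable_comparison_test'[OF trans_prob_summable[of m u], of 0]) (rule le)
  have "ennreal (exp (q * grid m 1) * ?h u) =
      ennreal (exp (q * grid m 1)) * skeleton_hit_value q x z m u"
    by (simp add: ennreal_mult enn2real_skeleton_hit_value)
  also have "\<dots> = (\<Sum>v. ennreal (trans_prob m u v * skel m v))"
    unfolding skeleton_hit_value_one_step[OF xz]
    by (intro suminf_cong)
       (auto simp: ennreal_mult enn2real_skeleton_hit_value with_boundary_def)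
  also have "\<dots> = ennreal (\<Sum>v. trans_prob m u v * skel m v)"
    by (rule suminf_ennreal2[OF _ sm]) (simp add: skel_bounds)
  finally have "exp (q * grid m 1) * ?h u = (\<Sum>v. trans_prob m u v * skel m v)"
    by (subst (asm) ennreal_inj) (auto intro!: suminf_nonneg sm simp: skel_bounds)
  also have "\<dots> = trans_prob m u u * skel m u + grid m 1 * (\<Sum>v. exit_rate m u v * skel m v)"
  proof -
    have "(\<lambda>v. trans_prob m u v * skel m v - (if v = u then trans_prob m u v * skel m v else 0)) sums
        ((\<Sum>v. trans_prob m u v * skel m v) - trans_prob m u u * skel m u)"
      by (intro sums_diff sums_single summable_sums sm)
    then have "(\<lambda>v. (trans_prob m u v * skel m v - (if v = u then trans_prob m u v * skel m v else 0)) / grid m 1) sums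
        (((\<Sum>v. trans_prob m u v * skel m v) - trans_prob m u u * skel m u) / grid m 1)"
      by (rule sums_divide)
    also have "(\<lambda>v. (trans_prob m u v * skel m v - (if v = u then trans_prob m u v * skel m v else 0)) / grid m 1)
        = (\<lambda>v. exit_rate m u v * skel m v)"
      by (auto simp: exit_rate_def)
    finally have "(\<Sum>v. exit_rate m u v * skel m v) =
        ((\<Sum>v. trans_prob m u v * skel m v) - trans_prob m u u * skel m u) / grid m 1"
      by (simp add: sums_iff)
    moreover have "grid m 1 \<noteq> 0" by (simp add: grid_def)
    ultimately show ?thesis by (simp del: One_nat_def)
  qed
  finally show ?thesis .
qed

lemma tendsto_skel_sum:
  "(\<lambda>m. \<Sum>v. exit_rate m u v * skel m v) \<longlonglongrightarrow> (\<Sum>v. (if v = u then 0 else Q u v) * limit_value v)"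
  by (rule tendsto_exit_rate_sum) (use skel_bounds tendsto_skel in auto)

lemma limit_value_bounds: "0 \<le> limit_value v" "limit_value v \<le> 1"
  by (rule LIMSEQ_le_const[OF tendsto_skel], use skel_bounds in auto)
     (rule LIMSEQ_le_const2[OF tendsto_skel], use skel_bounds in auto)

lemma off_diagonal_sum:
  "(\<Sum>v. (if v = u then 0 else Q u v) * limit_value v) = (\<Sum>v. Q u v * limit_value v) - Q u u * limit_value u"
proof -
  let ?O = "\<lambda>v. if v = u then 0 else Q u v"
  have le: "norm (?O v * limit_value v) \<le> ?O v" for v
    using mult_left_mono[OF limit_value_bounds(2), of "?O v" v] limit_value_bounds(1)[of v] Q_nonneg[of u v]
    by (auto simp: abs_mult)
  have "summable ?O" using Q_off_diagonal_sums by (rule sums_summable)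
  then have "summable (\<lambda>v. ?O v * limit_value v)"
    by (rule summable_comparison_test'[of _ 0]) (rule le)
  then have "(\<lambda>v. ?O v * limit_value v + (if v = u then Q u v * limit_value v else 0)) sums
     ((\<Sum>v. ?O v * limit_value v) + Q u u * limit_value u)"
    by (intro sums_add sums_single summable_sums)
  moreover have "(\<lambda>v. ?O v * limit_value v + (if v = u then Q u v * limit_value v else 0)) = (\<lambda>v. Q u v * limit_value v)"
    by auto
  ultimately show ?thesis by (simp add: sums_iff)
qed

text \<open>The one-step equation divided by the mesh, with the diagonal term moved to the other
  side: the coefficient of the value at \<open>u\<close> tends to \<open>q - Q u u\<close>.\<close>

lemma generator_hit_value:
  assumes u: "u \<noteq> x" "u \<noteq> z"
  shows "(\<Sum>v. Q u v * limit_value v) = q * limit_value u"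
proof -
  have pos: "grid m 1 > 0" for m by simp
  have "(\<Sum>v. exit_rate m u v * skel m v) =
      ((exp (q * grid m 1) - 1) / grid m 1 + (1 - trans_prob m u u) / grid m 1) * skel m u" for m
    using skeleton_one_step_real[of m u] u pos[of m]
    by (simp add: with_boundary_def field_simps del: One_nat_def grid_pos)
  moreover have "(\<lambda>m. ((exp (q * grid m 1) - 1) / grid m 1 + (1 - trans_prob m u u) / grid m 1) * skel m u)
      \<longlonglongrightarrow> (q + - Q u u) * limit_value u"
    by (intro tendsto_intros tendsto_exp_grid_quotient tendsto_total_exit_rate tendsto_skel)
  ultimately have "(\<lambda>m. \<Sum>v. exit_rate m u v * skel m v) \<longlonglongrightarrow> (q + - Q u u) * limit_value u"
    by simp
  from LIMSEQ_unique[OF tendsto_skel_sum this] show ?thesis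
    by (simp add: off_diagonal_sum algebra_simps)
qed

text \<open>The boundary value at \<open>z\<close> is \<open>0\<close>, so the diagonal term drops
  out. The mesh and the geometric factor \<open>1 / (1 - trans_prob m z z)\<close> combine to the
  inverse of a rate tending to \<open>- Q z z\<close>, which is the normalisation of the excursion
  measure.\<close>

lemma excursion_laplace_eq_generator:
  assumes Qz: "Q z z \<noteq> 0"
  shows "excursion_laplace P X Q q x z = (\<Sum>v. Q z v * limit_value v)"
proof -
  let ?S = "\<lambda>m. \<Sum>v. exit_rate m z v * skel m v"
  let ?E = "\<lambda>m. enn2real (\<integral>\<^sup>+\<omega>. skeleton_excursion_weight q x z m (X \<omega>) \<partial>P z)"
  have "0 \<le> - Q z z"
    by (rule sums_le[OF _ sums_zero Q_off_diagonal_sums]) (simp add: Q_nonneg)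
  then have "0 < - Q z z" using Qz by simp
  then have "\<forall>\<^sub>F m in sequentially. 0 < (1 - trans_prob m z z) / grid m 1"
    by (rule order_tendstoD[OF tendsto_total_exit_rate])
  then have "\<forall>\<^sub>F m in sequentially. ?E m = ?S m / ((1 - trans_prob m z z) / grid m 1)"
  proof eventually_elim
    case (elim m)
    let ?p = "trans_prob m z z" and ?h = "enn2real (skeleton_hit_value q x z m z)"
    have pos: "grid m 1 > 0" by simp
    then have p: "?p < 1" using elim by (simp add: zero_less_divide_iff del: One_nat_def grid_pos)
    have "(\<Sum>j. ennreal ?p ^ j) = (\<Sum>j. ennreal (?p ^ j))"
      by (simp add: ennreal_power)
    also have "\<dots> = ennreal (\<Sum>j. ?p ^ j)"
      using p by (intro suminf_ennreal2) auto
    also have "(\<Sum>j. ?p ^ j) = 1 / (1 - ?p)"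
      using p by (simp add: suminf_geometric)
    finally have "(\<integral>\<^sup>+\<omega>. skeleton_excursion_weight q x z m (X \<omega>) \<partial>P z) =
        ennreal (1 / (1 - ?p)) * (ennreal (exp (q * grid m 1)) * ennreal ?h)"
      by (simp add: nn_integral_skeleton_excursion_weight enn2real_skeleton_hit_value)
    also have "\<dots> = ennreal (1 / (1 - ?p) * (exp (q * grid m 1) * ?h))"
      by (subst ennreal_mult'', simp, subst ennreal_mult'', simp, rule refl)
    finally have "?E m = 1 / (1 - ?p) * (exp (q * grid m 1) * ?h)"
      using p by (simp add: enn2real_ennreal)
    also have "exp (q * grid m 1) * ?h = grid m 1 * ?S m"
      using skeleton_one_step_real[of m z] xz by (simp add: with_boundary_def)
    finally show ?case using p pos by (simp add: field_simps del: One_nat_def grid_pos)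
  qed
  moreover have "(\<lambda>m. ?S m / ((1 - trans_prob m z z) / grid m 1)) \<longlonglongrightarrow>
      (\<Sum>v. (if v = z then 0 else Q z v) * limit_value v) / (- Q z z)"
    using Qz by (intro tendsto_divide tendsto_skel_sum tendsto_total_exit_rate) simp
  ultimately have "?E \<longlonglongrightarrow> (\<Sum>v. (if v = z then 0 else Q z v) * limit_value v) / (- Q z z)"
    by (simp add: tendsto_cong)
  from LIMSEQ_unique[OF tendsto_excursion_value[OF q xz] this]
  show ?thesis
    using Qz xz by (simp add: excursion_laplace_eq off_diagonal_sum) (simp add: with_boundary_def)
qed

end

section \<open>Jumps of rate zero do not occur\<close>

lemma prob_two_grid_points_le:
  "measure (P u) {\<omega> \<in> space M. X \<omega> (grid m n) = Some v \<and> X \<omega> (grid m (Suc n)) = Some w} \<le> trans_prob m v w"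
proof -
  interpret prob_space "P u" by (rule prob)
  interpret past: sigma_algebra "space M" "past M X (grid m n)"
    by (rule sigma_algebra_past)
  have "measure (P u) (space M \<inter> {\<omega> \<in> space M. X \<omega> (grid m n) = Some v \<and> X \<omega> (grid m n + grid m 1) = Some w}) =
     measure (P u) (space M \<inter> {\<omega> \<in> space M. X \<omega> (grid m n) = Some v}) * trans_prob m v w"
    unfolding trans_prob_def by (rule markov) auto
  also have "\<dots> \<le> 1 * trans_prob m v w"
    by (intro mult_right_mono) auto
  also have "space M \<inter> {\<omega> \<in> space M. X \<omega> (grid m n) = Some v \<and> X \<omega> (grid m n + grid m 1) = Some w} =
      {\<omega> \<in> space M. X \<omega> (grid m n) = Some v \<and> X \<omega> (grid m (Suc n)) = Some w}"
    by (auto simp: grid_Suc[of m n])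
  finally show ?thesis by simp
qed

lemma AE_start: "AE \<omega> in P u. X \<omega> 0 = Some u"
proof -
  interpret prob_space "P u" by (rule prob)
  from AE_prob_1[OF start[of u]] show ?thesis by auto
qed

text \<open>The expected number of grid steps from \<open>C \<inter> {..N}\<close> into \<open>B\<close> up to time \<open>T\<close> tends to
  \<open>T\<close> times the vanishing total rate.\<close>

lemma AE_no_transition:
  assumes Q0: "\<And>v w. v \<in> C \<Longrightarrow> w \<in> B \<Longrightarrow> Q v w = 0"
    and B: "finite B" "B \<inter> C = {}" and u: "u \<in> C"
  shows "AE \<omega> in P u. \<not> (\<exists>t>0. X \<omega> t \<in> Some ` B \<and> (\<forall>s. 0 < s \<and> s \<le> t \<longrightarrow> X \<omega> s \<in> Some ` (B \<union> C)))"
proof -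
  interpret prob_space "P u" by (rule prob)
  define F where "F m n v w = {\<omega> \<in> space M. X \<omega> (grid m n) = Some v \<and> X \<omega> (grid m (Suc n)) = Some w}" for m n v w
  \<comment> \<open>The cut-off at \<open>N\<close> keeps the union finite, so its bound passes to
    the limit term by term, without uniformity over \<open>C\<close>.\<close>
  define D where "D T N m = (\<Union>(n, v, w)\<in>{..<T * Suc m} \<times> (C \<inter> {..N}) \<times> B. F m n v w)" for T N m :: nat
  have F: "F m n v w \<in> sets M" for m n v w
  proof -
    have "Measurable.pred M (\<lambda>\<omega>. X \<omega> (grid m n) = Some v \<and> X \<omega> (grid m (Suc n)) = Some w)"
      by (intro pred_intros_logic pred_X_eq) auto
    then show ?thesis by (simp add: F_def pred_def)
  qed
  have D: "D T N m \<in> sets M" for T N m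
    unfolding D_def using F B(1) by (intro sets.finite_UN) auto
  have D_le: "measure (P u) (D T N m) \<le> real T * (\<Sum>v\<in>C \<inter> {..N}. \<Sum>w\<in>B. exit_rate m v w)" for T N m
  proof -
    have "measure (P u) (D T N m) \<le>
        (\<Sum>(n, v, w)\<in>{..<T * Suc m} \<times> (C \<inter> {..N}) \<times> B. measure (P u) (F m n v w))"
      unfolding D_def using F B(1)
      by (intro order_trans[OF measure_UNION_le]) (auto simp: case_prod_beta)
    also have "\<dots> \<le> (\<Sum>(n, v, w)\<in>{..<T * Suc m} \<times> (C \<inter> {..N}) \<times> B. trans_prob m v w)"
      unfolding F_def by (intro sum_mono) (auto intro: prob_two_grid_points_le)
    also have "\<dots> = real (T * Suc m) * (\<Sum>v\<in>C \<inter> {..N}. \<Sum>w\<in>B. trans_prob m v w)"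
      using B(1) by (simp add: sum.cartesian_product[symmetric])
    also have "\<dots> = real T * (\<Sum>v\<in>C \<inter> {..N}. \<Sum>w\<in>B. real (Suc m) * trans_prob m v w)"
      by (simp add: sum_distrib_left mult.assoc del: of_nat_Suc mult_Suc_right)
    also have "\<dots> = real T * (\<Sum>v\<in>C \<inter> {..N}. \<Sum>w\<in>B. exit_rate m v w)"
      using B(2) by (intro arg_cong2[where f = "(*)"] sum.cong) (auto simp: exit_rate_def grid_def)
    finally show ?thesis .
  qed
  have "(\<lambda>m. real T * (\<Sum>v\<in>C \<inter> {..N}. \<Sum>w\<in>B. exit_rate m v w)) \<longlonglongrightarrow>
      real T * (\<Sum>v\<in>C \<inter> {..N}. \<Sum>w\<in>B. if w = v then 0 else Q v w)" for T N
    by (intro tendsto_intros tendsto_exit_rate)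
  moreover have "(\<Sum>v\<in>C \<inter> {..N}. \<Sum>w\<in>B. if w = v then 0 else Q v w) = 0" for N
    using Q0 by (auto intro!: sum.neutral)
  ultimately have lim: "(\<lambda>m. real T * (\<Sum>v\<in>C \<inter> {..N}. \<Sum>w\<in>B. exit_rate m v w)) \<longlonglongrightarrow> 0" for T N
    by simp
  \<comment> \<open>A path with a forbidden passage lies in \<open>D T N m\<close> for all large
    \<open>m\<close>. The intersection from \<open>k\<close> on is null, being contained in sets
    whose probability bounds tend to \<open>0\<close>.\<close>
  have "AE \<omega> in P u. \<omega> \<notin> (\<Inter>m\<in>{k..}. D T N m)" for T N k
  proof (rule AE_not_in)
    have sets: "(\<Inter>m\<in>{k..}. D T N m) \<in> sets M"
      using D by (intro sets.countable_INT') auto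
    have "measure (P u) (\<Inter>m\<in>{k..}. D T N m) \<le> 0"
    proof (rule LIMSEQ_le_const[OF lim], intro exI allI impI)
      fix m assume "k \<le> m"
      then have "measure (P u) (\<Inter>m\<in>{k..}. D T N m) \<le> measure (P u) (D T N m)"
        using D by (intro finite_measure_mono) auto
      also note D_le
      finally show "measure (P u) (\<Inter>m\<in>{k..}. D T N m) \<le>
        real T * (\<Sum>v\<in>C \<inter> {..N}. \<Sum>w\<in>B. exit_rate m v w)" .
    qed
    then have "emeasure (P u) (\<Inter>m\<in>{k..}. D T N m) = 0"
      by (simp add: emeasure_P measure_le_0_iff)
    then show "(\<Inter>m\<in>{k..}. D T N m) \<in> null_sets (P u)"
      using sets by (intro null_setsI) auto
  qed
  then have "AE \<omega> in P u. \<forall>T N k. \<omega> \<notin> (\<Inter>m\<in>{k..}. D T N m)"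
    by (intro AE_all_countable[THEN iffD2] allI)
  moreover have "AE \<omega> in P u. \<omega> \<in> space M" using AE_space[of "P u"] by simp
  ultimately show ?thesis
    using AE_start[of u]
  proof eventually_elim
    case (elim \<omega>)
    show ?case
    proof
      assume "\<exists>t>0. X \<omega> t \<in> Some ` B \<and> (\<forall>s. 0 < s \<and> s \<le> t \<longrightarrow> X \<omega> s \<in> Some ` (B \<union> C))"
      then obtain t where t: "0 < t" "X \<omega> t \<in> Some ` B"
        "\<And>s. 0 < s \<Longrightarrow> s \<le> t \<Longrightarrow> X \<omega> s \<in> Some ` (B \<union> C)" by blast
      obtain T N where "\<forall>\<^sub>F m in sequentially. \<exists>n<T * Suc m. \<exists>v\<in>C. v \<le> N \<and>
          X \<omega> (grid m n) = Some v \<and> X \<omega> (grid m (Suc n)) \<in> Some ` B"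
        using eventually_grid_transition[OF paths[OF elim(2)] elim(3) u t] by blast
      then have "\<forall>\<^sub>F m in sequentially. \<omega> \<in> D T N m"
        by eventually_elim (use elim(2) in \<open>force simp: D_def F_def\<close>)
      then obtain k where "\<And>m. k \<le> m \<Longrightarrow> \<omega> \<in> D T N m" by (auto simp: eventually_sequentially)
      then have "\<omega> \<in> (\<Inter>m\<in>{k..}. D T N m)" by blast
      then show False using elim(1) by blast
    qed
  qed
qed

end

section \<open>Skip-free chains\<close>

context skip_free_chain
begin

text \<open>If this rate vanished, then by skip-freeness so would all rates from
  \<open>{z..}\<close> into \<open>{..<z}\<close>, and the chain started in \<open>z\<close> could
  not reach \<open>0\<close>, against irreducibility.\<close>

lemma Q_down_pos:
  assumes "1 \<le> z"
  shows "0 < Q z (z - 1)"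
proof (rule ccontr)
  interpret prob_space "P z" by (rule prob)
  assume "\<not> 0 < Q z (z - 1)"
  then have "Q z (z - 1) = 0" using Q_nonneg[of z "z - 1"] assms by auto
  then have Q0: "Q v w = 0" if "v \<in> {z..}" "w \<in> {..<z}" for v w
    using skip_free[of w v] that by (cases "v = z \<and> w = z - 1") auto
  have "AE \<omega> in P z. \<not> (\<exists>t>0. X \<omega> t \<in> Some ` {..<z} \<and>
      (\<forall>s. 0 < s \<and> s \<le> t \<longrightarrow> X \<omega> s \<in> Some ` ({..<z} \<union> {z..})))"
    by (rule AE_no_transition[OF Q0]) auto
  moreover have "AE \<omega> in P z. \<omega> \<in> space M" using AE_space[of "P z"] by simp
  ultimately have "AE \<omega> in P z. \<not> hit_time {0} (X \<omega>) < \<infinity>"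
  proof eventually_elim
    case (elim \<omega>)
    show ?case
    proof
      assume "hit_time {0} (X \<omega>) < \<infinity>"
      then obtain t where t: "t > 0" "X \<omega> t = Some 0" unfolding hit_time_less_iff by auto
      have *: "X \<omega> s \<in> Some ` ({..<z} \<union> {z..})" if s: "0 < s" "s \<le> t" for s
        by (rule cadlag_killed_alive[OF paths[OF elim(2)] _ s(2) t(2)])
           (use s in \<open>auto simp: image_iff\<close>)
      have "X \<omega> t \<in> Some ` {..<z}" using t assms by auto
      then show False using elim(1) t(1) * by blast
    qed
  qed
  then have "measure (P z) {\<omega> \<in> space M. hit_time {0} (X \<omega>) < \<infinity>} = 0"
    by (intro prob_eq_0[THEN iffD2]) auto
  then show False using irreducible[OF assms, of 0] by simp
qed

text \<open>A jump from above \<open>z\<close> to below \<open>z\<close> drops at least two levels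
  and has rate \<open>0\<close>, so \<open>x\<close> is not hit before \<open>z\<close>. This gives
  the limit functions finite support.\<close>

lemma hit_value_above:
  assumes "x < z" "z < u"
  shows "hit_value q x z u = 0"
proof -
  have "AE \<omega> in P u. \<not> (\<exists>t>0. X \<omega> t \<in> Some ` {..<z} \<and>
      (\<forall>s. 0 < s \<and> s \<le> t \<longrightarrow> X \<omega> s \<in> Some ` ({..<z} \<union> {z<..})))"
    by (rule AE_no_transition) (use assms in \<open>auto intro: skip_free\<close>)
  moreover have "AE \<omega> in P u. \<omega> \<in> space M" using AE_space[of "P u"] by simp
  ultimately have "AE \<omega> in P u. ennreal (hit_weight q x z (X \<omega>)) = 0"
  proof eventually_elim
    case (elim \<omega>)
    have "\<not> hit_time {x} (X \<omega>) < hit_time {z} (X \<omega>)"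
    proof
      assume "hit_time {x} (X \<omega>) < hit_time {z} (X \<omega>)"
      then obtain t where t: "t > 0" "X \<omega> t = Some x" "ereal t < hit_time {z} (X \<omega>)"
        unfolding hit_time_less_iff[of "{x}"] by auto
      have *: "X \<omega> s \<in> Some ` ({..<z} \<union> {z<..})" if s: "0 < s" "s \<le> t" for s
      proof -
        obtain y where y: "X \<omega> s = Some y"
          using cadlag_killed_alive[OF paths[OF elim(2)] _ s(2) t(2)] s(1) by force
        have "y \<noteq> z"
        proof
          assume "y = z"
          then have "hit_time {z} (X \<omega>) \<le> ereal s" using s y by (intro hit_time_le[of _ _ z]) auto
          also have "\<dots> \<le> ereal t" using s by simp
          finally show False using t(3) by simp
        qed
        then show ?thesis using y by auto
      qed
      have "X \<omega> t \<in> Some ` {..<z}" using t assms by auto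
      then show False using elim(1) t(1) * by blast
    qed
    then show ?case by (simp add: hit_weight_def)
  qed
  then have "(\<integral>\<^sup>+\<omega>. ennreal (hit_weight q x z (X \<omega>)) \<partial>P u) = (\<integral>\<^sup>+\<omega>. 0 \<partial>P u)"
    by (rule nn_integral_cong_AE)
  then show ?thesis by (simp add: hit_value_def)
qed

section \<open>Downward recursion and the scale functions\<close>

lemma generator_lowest:
  assumes "\<And>w. n < w \<Longrightarrow> f w = 0"
  shows "(\<Sum>w. Q (Suc n) w * f w) = Q (Suc n) n * f n"
proof (rule suminf_single)
  fix w assume "w \<noteq> n"
  then show "Q (Suc n) w * f w = 0"
    using assms[of w] skip_free[of w "Suc n"] by (cases "n < w") auto
qed

text \<open>The equation at \<open>n + 1\<close> contains \<open>f n\<close> with a nonzero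
  coefficient and otherwise only higher values. Hence equations strictly above \<open>x\<close>
  reach \<open>x\<close> itself, and the value at \<open>z - 1\<close> is the one free parameter,
  which the first hypothesis sets to zero.\<close>

lemma backward_zero:
  assumes f: "\<And>w. z \<le> Suc w \<Longrightarrow> f w = 0"
    and gen: "\<And>v. x < v \<Longrightarrow> v < z \<Longrightarrow> (\<Sum>w. Q v w * f w) = q * f v"
    and "x < z" "x \<le> v"
  shows "f v = 0"
proof -
  have "\<forall>w\<ge>x. f w = 0"
  proof (rule inc_induct[of x "z - 1"])
    show "x \<le> z - 1" using \<open>x < z\<close> by simp
    show "\<forall>w\<ge>z - 1. f w = 0" using f by simp
    fix n assume n: "x \<le> n" "n < z - 1" and IH: "\<forall>w\<ge>Suc n. f w = 0"
    have "Q (Suc n) n * f n = (\<Sum>w. Q (Suc n) w * f w)"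
      using IH by (intro generator_lowest[symmetric]) auto
    also have "\<dots> = 0" using gen[of "Suc n"] n IH by simp
    finally have "f n = 0" using Q_down_pos[of "Suc n"] by simp
    then show "\<forall>w\<ge>n. f w = 0" using IH by (metis le_eq_less_or_eq Suc_leI)
  qed
  then show ?thesis using \<open>x \<le> v\<close> by blast
qed

lemma Q_diag_nonzero:
  assumes "1 \<le> z"
  shows "Q z z \<noteq> 0"
proof
  assume "Q z z = 0"
  then have "(\<lambda>v. if v = z then 0 else Q z v) sums 0" using Q_off_diagonal_sums[of z] by simp
  then have "\<forall>v. (if v = z then 0 else Q z v) = 0"
    using Q_nonneg[of z] by (subst suminf_eq_zero_iff[symmetric]) (auto simp: sums_iff)
  from spec[OF this, of "z - 1"] have "(if z - 1 = z then 0 else Q z (z - 1)) = 0" .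
  moreover have "z - 1 \<noteq> z" using assms by simp
  ultimately show False using Q_down_pos[OF assms] by simp
qed

context
  fixes q :: real
  assumes q: "0 \<le> q"
begin

lemma limit_value_zero: "x < z \<Longrightarrow> z \<le> v \<Longrightarrow> with_boundary x z (hit_value q x z) v = 0"
  using hit_value_above[of x z v q] by (auto simp: with_boundary_def)

lemma excursion_laplace_eq_down:
  assumes "x < z"
  shows "excursion_laplace P X Q q x z = Q z (z - 1) * with_boundary x z (hit_value q x z) (z - 1)"
proof -
  obtain n where n: "z = Suc n" using assms by (cases z) auto
  show ?thesis
    using excursion_laplace_eq_generator[OF q, of x z] Q_diag_nonzero[of z] assms
      generator_lowest[of n "with_boundary x z (hit_value q x z)"] limit_value_zero[OF assms]
    by (simp add: n)
qed

text \<open>Probabilistically this is the strong Markov property at the hitting time of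
  \<open>x\<close>, through which every way from \<open>z - 1\<close> down to \<open>0\<close>
  leads.\<close>

lemma limit_value_chain:
  assumes "x < z"
  shows "with_boundary 0 z (hit_value q 0 z) x * with_boundary x z (hit_value q x z) (z - 1) =
    with_boundary 0 z (hit_value q 0 z) (z - 1)" (is "?f x * ?g (z - 1) = ?f (z - 1)")
proof -
  \<comment> \<open>The combination of the two solutions that vanishes at \<open>z - 1\<close>; as
    \<open>?g x = 1\<close>, its vanishing at \<open>x\<close> is the claim.\<close>
  let ?d = "\<lambda>v. ?f v * ?g (z - 1) - ?g v * ?f (z - 1)"
  have zero: "?f w = 0" "?g w = 0" if "z \<le> w" for w
    using limit_value_zero[OF _ that] assms by auto
  have finite_sum: "(\<Sum>w. Q v w * h w) = (\<Sum>w<z. Q v w * h w)" if "\<And>w. z \<le> w \<Longrightarrow> h w = 0" for v h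
    by (rule suminf_finite) (use that in auto)
  have "?d x = 0"
  proof (rule backward_zero[where f = ?d and v = x and x = x and z = z and q = q])
    show "?d w = 0" if "z \<le> Suc w" for w
      using zero[of w] that by (cases "w = z - 1") auto
    fix v assume v: "x < v" "v < z"
    have "(\<Sum>w. Q v w * ?f w) = q * ?f v" "(\<Sum>w. Q v w * ?g w) = q * ?g v"
      using v by (auto intro!: generator_hit_value q)
    then have "(\<Sum>w<z. Q v w * ?f w) = q * ?f v" "(\<Sum>w<z. Q v w * ?g w) = q * ?g v"
      using finite_sum[of ?f v] finite_sum[of ?g v] zero by auto
    moreover have "(\<Sum>w. Q v w * ?d w) =
      (\<Sum>w<z. Q v w * ?f w) * ?g (z - 1) - (\<Sum>w<z. Q v w * ?g w) * ?f (z - 1)"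
      using zero by (subst finite_sum) (auto simp: algebra_simps sum_subtractf sum_distrib_left sum_distrib_right)
    ultimately show "(\<Sum>w. Q v w * ?d w) = q * ?d v"
      by (simp add: algebra_simps)
  qed (use assms in auto)
  moreover have "?g x = 1" by (simp add: with_boundary_def)
  ultimately show ?thesis by simp
qed

text \<open>Vanishing at \<open>z - 1\<close> would propagate down to \<open>0\<close>, where the
  boundary value is \<open>1\<close>.\<close>

lemma limit_value_nonzero:
  assumes "1 \<le> z"
  shows "with_boundary 0 z (hit_value q 0 z) (z - 1) \<noteq> 0"
proof
  let ?f = "with_boundary 0 z (hit_value q 0 z)"
  assume 0: "?f (z - 1) = 0"
  have "?f 0 = 0"
  proof (rule backward_zero[where f = ?f and v = 0 and x = 0 and z = z and q = q])
    show "?f w = 0" if "z \<le> Suc w" for w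
      using limit_value_zero[of 0 z w] 0 assms that by (cases "w = z - 1") auto
    show "(\<Sum>w. Q v w * ?f w) = q * ?f v" if "0 < v" "v < z" for v
      using that by (intro generator_hit_value q) auto
  qed (use assms in auto)
  then show False by (simp add: with_boundary_def)
qed

text \<open>By definition each entry of column \<open>z\<close> involves another function, with
  target \<open>x\<close>, whereas the matrix equation acts along the column. The factorisation
  makes the column a multiple of the single function with target \<open>0\<close>.\<close>

lemma scale_fn_eq:
  assumes "1 \<le> z"
  shows "scale_fn P X Q q x z = with_boundary 0 z (hit_value q 0 z) x /
    (Q z (z - 1) * with_boundary 0 z (hit_value q 0 z) (z - 1))"
proof (cases "x < z")
  case True
  have "with_boundary x z (hit_value q x z) (z - 1) \<noteq> 0"
    "with_boundary 0 z (hit_value q 0 z) x \<noteq> 0"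
    using limit_value_chain[OF True] limit_value_nonzero[OF assms] by auto
  then show ?thesis
    using True Q_down_pos[OF assms]
    unfolding limit_value_chain[OF True, symmetric]
    by (simp add: scale_fn_def excursion_laplace_eq_down)
next
  case False
  then show ?thesis using limit_value_zero[of 0 z x] assms by (simp add: scale_fn_def)
qed

lemma triangular_scale_fn: "triangular (scale_fn P X Q q)"
  by (simp add: triangular_def scale_fn_def)

lemma mat_prod_scale_fn:
  assumes x: "1 \<le> x"
  shows "mat_prod Q (scale_fn P X Q q) x y = id_mat x y + q * scale_fn P X Q q x y"
proof (cases "y = 0")
  case True
  then show ?thesis using x by (simp add: mat_prod_def scale_fn_def id_mat_def)
next
  case False
  then have y: "1 \<le> y" by simp
  let ?f = "with_boundary 0 y (hit_value q 0 y)"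
  define c where "c = Q y (y - 1) * ?f (y - 1)"
  have c: "c \<noteq> 0" using limit_value_nonzero[OF y] Q_down_pos[OF y] by (simp add: c_def)
  have W: "scale_fn P X Q q v y = ?f v / c" for v
    by (simp add: scale_fn_eq[OF y] c_def)
  have zero: "?f v = 0" if "y \<le> v" for v
    using limit_value_zero[OF _ that, of 0] y by simp
  have "mat_prod Q (scale_fn P X Q q) x y = (\<Sum>u. Q x u * ?f u) / c"
  proof -
    have "(\<Sum>u. Q x u * ?f u) = (\<Sum>u<y. Q x u * ?f u)"
      "(\<Sum>u. Q x u * (?f u / c)) = (\<Sum>u<y. Q x u * (?f u / c))"
      by (rule suminf_finite; use zero in auto)+
    then show ?thesis by (simp add: mat_prod_def W sum_divide_distrib)
  qed
  \<comment> \<open>For \<open>x < y\<close> this is the equation of the limit function. For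
    \<open>x = y\<close> only the entry at \<open>y - 1\<close> meets the support, which gives
    \<open>c\<close>. For \<open>x > y\<close> the row starts at \<open>x - 1 >= y\<close>, beyond
    the support.\<close>
  also have "(\<Sum>u. Q x u * ?f u) = c * id_mat x y + q * ?f x"
  proof (cases x y rule: linorder_cases)
    case less
    then have "(\<Sum>u. Q x u * ?f u) = q * ?f x"
      using x y by (intro generator_hit_value q) auto
    then show ?thesis using less by (simp add: id_mat_def)
  next
    case equal
    obtain n where "y = Suc n" using y by (cases y) auto
    then show ?thesis
      using equal generator_lowest[of n ?f] zero by (simp add: c_def id_mat_def)
  next
    case greater
    have "Q x u * ?f u = 0" for u
      using zero[of u] skip_free[of u x] greater by (cases "y \<le> u") auto
    then have "(\<lambda>u. Q x u * ?f u) = (\<lambda>_. 0)" by (rule ext)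
    then show ?thesis using greater zero[of x] by (simp add: id_mat_def)
  qed
  finally show ?thesis using c by (simp add: W field_simps)
qed

text \<open>Row \<open>y\<close> of the equation, where the identity matrix contributes its
  \<open>1\<close>, fixes the entry of column \<open>y\<close> at \<open>y - 1\<close>. The
  difference of two solutions then vanishes from \<open>y - 1\<close> on and solves the homogeneous
  equations, hence vanishes down to row \<open>0\<close>.\<close>

lemma triangular_solution_unique:
  assumes F: "triangular F" "\<And>x y. 1 \<le> x \<Longrightarrow> mat_prod Q F x y = id_mat x y + q * F x y"
    and G: "triangular G" "\<And>x y. 1 \<le> x \<Longrightarrow> mat_prod Q G x y = id_mat x y + q * G x y"
  shows "F = G"
proof (intro ext)
  fix v y
  show "F v y = G v y"
  proof (cases y)
    case 0
    then show ?thesis using F(1) G(1) by (simp add: triangular_def)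
  next
    case (Suc n)
    have last: "Q (Suc n) n * H n y = 1"
      if H: "triangular H" "\<And>x y. 1 \<le> x \<Longrightarrow> mat_prod Q H x y = id_mat x y + q * H x y" for H
    proof -
      have "Q (Suc n) n * H n y = mat_prod Q H (Suc n) y"
        unfolding mat_prod_def using H(1) Suc
        by (intro generator_lowest[of n "\<lambda>u. H u y", symmetric]) (auto simp: triangular_def)
      also have "\<dots> = 1" using H Suc by (simp add: id_mat_def triangular_def)
      finally show ?thesis .
    qed
    have "Q (Suc n) n * F n y = Q (Suc n) n * G n y"
      using last[OF F] last[OF G] by simp
    then have n: "F n y = G n y" using Q_down_pos[of "Suc n"] by simp
    have "F v y - G v y = 0"
    proof (rule backward_zero[where x = 0 and z = y and q = q and v = v and f = "\<lambda>v. F v y - G v y"])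
      show "F w y - G w y = 0" if "y \<le> Suc w" for w
        using n F(1) G(1) that Suc by (cases "w = n") (auto simp: triangular_def)
      fix v assume v: "0 < v" "v < y"
      have "(\<Sum>w. Q v w * (F w y - G w y)) = mat_prod Q F v y - mat_prod Q G v y"
      proof -
        have "(\<Sum>w. Q v w * (F w y - G w y)) = (\<Sum>w\<le>y. Q v w * (F w y - G w y))"
          by (rule suminf_finite) (use F(1) G(1) in \<open>auto simp: triangular_def\<close>)
        then show ?thesis
          using F(1) G(1) by (simp add: mat_prod_finite triangular_imp_upper algebra_simps sum_subtractf)
      qed
      then show "(\<Sum>w. Q v w * (F w y - G w y)) = q * (F v y - G v y)"
        using F(2)[of v y] G(2)[of v y] v by (simp add: algebra_simps)
    qed (use Suc in auto)
    then show ?thesis by simp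
  qed
qed

text \<open>Multiplying the fixed point equation \<open>N = W + q W N\<close> by \<open>Q\<close>
  gives \<open>I + q N\<close> in all rows \<open>x >= 1\<close>, so uniqueness applies. The facts
  for parameter \<open>0\<close> are premises because \<open>q\<close> is fixed in the surrounding
  context.\<close>

lemma scale_fn_eq_neumann: "scale_fn P X Q q = neumann (scale_fn P X Q 0) q"
  if scale0: "\<And>x y. 1 \<le> x \<Longrightarrow> mat_prod Q (scale_fn P X Q 0) x y = id_mat x y"
    and tri0: "triangular (scale_fn P X Q 0)"
proof (rule triangular_solution_unique[OF triangular_scale_fn mat_prod_scale_fn])
  let ?W = "scale_fn P X Q 0" and ?R = "neumann (scale_fn P X Q 0) q"
  show R: "triangular ?R" by (rule triangular_neumann[OF tri0])
  note upper = triangular_imp_upper[OF tri0] triangular_imp_upper[OF R]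
  fix x y :: nat assume x: "1 \<le> x"
  have "mat_prod Q ?R x y = (\<Sum>u\<le>y. Q x u * (?W u y + q * mat_prod ?W ?R u y))"
    unfolding mat_prod_finite[OF upper(2), of Q] by (simp flip: neumann_fixpoint(2)[OF tri0])
  also have "\<dots> = mat_prod Q ?W x y + q * mat_prod Q (mat_prod ?W ?R) x y"
    by (simp add: mat_prod_finite[OF upper(1)] mat_prod_finite[OF upper_mat_prod[OF upper]]
        algebra_simps sum.distrib sum_distrib_left)
  also have "mat_prod Q (mat_prod ?W ?R) x y = mat_prod (mat_prod Q ?W) ?R x y"
    by (simp add: mat_prod_assoc upper)
  also have "\<dots> = mat_prod id_mat ?R x y"
    by (simp add: mat_prod_def scale0[OF x, unfolded mat_prod_def])
  finally show "mat_prod Q ?R x y = id_mat x y + q * ?R x y"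
    by (simp add: scale0[OF x] mat_prod_id_left[OF upper(2)])
qed

end

end

theorem theorem1p1:
  fixes M :: "'a measure"
    and P :: "nat \<Rightarrow> 'a measure"
    and X :: "'a \<Rightarrow> real \<Rightarrow> nat option"
    and Q :: "nat \<Rightarrow> nat \<Rightarrow> real"
    and Wq :: "real \<Rightarrow> nat \<Rightarrow> nat \<Rightarrow> real"
    and W :: "nat \<Rightarrow> nat \<Rightarrow> real"
  assumes chain: "skip_free_chain M P X Q"
  defines "Wq \<equiv> scale_fn P X Q"
    and "W \<equiv> Wq 0"
  shows
    "(\<forall>q\<ge>0. \<forall>F. (triangular F \<and>
          (\<forall>x\<ge>1. \<forall>y. mat_prod Q F x y = id_mat x y + q * F x y)) \<longleftrightarrow> F = Wq q)
     \<and> (\<forall>q\<ge>0. \<forall>x y.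
          (\<lambda>n. q ^ n * mat_pow W (n + 1) x y) sums Wq q x y \<and>
          Wq q x y = (\<Sum>n | int n \<le> int y - int x - 1. q ^ n * mat_pow W (n + 1) x y))
     \<and> (\<exists>!V. entire_extension Wq V)
     \<and> (\<forall>V. entire_extension Wq V \<longrightarrow>
          (\<forall>x y. \<exists>p. \<forall>q. V q x y = poly p q) \<and>
          (\<forall>q. let Wc = (\<lambda>x y. complex_of_real (W x y));
                   A = (\<lambda>x y. id_mat x y - q * Wc x y)
               in upper_invertible A \<and>
                  V q = mat_prod (upper_inv A) Wc \<and>
                  V q = mat_prod Wc (upper_inv A)))"
proof -
  interpret skip_free_chain M P X Q by (rule chain)
  have tri: "triangular (Wq q)" if "0 \<le> q" for q
    unfolding Wq_def by (rule triangular_scale_fn[OF that])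
  have eq: "mat_prod Q (Wq q) x y = id_mat x y + q * Wq q x y" if "0 \<le> q" "1 \<le> x" for q x y
    unfolding Wq_def by (rule mat_prod_scale_fn[OF that])
  have W: "triangular W" unfolding W_def by (rule tri) simp
  have neumann: "Wq q = neumann W q" if "0 \<le> q" for q
    unfolding W_def Wq_def
    by (rule scale_fn_eq_neumann[OF that]) (use eq[of 0] tri[of 0] in \<open>auto simp: Wq_def\<close>)
  define Wc where "Wc = (\<lambda>x y. complex_of_real (W x y))"
  have Wc: "triangular Wc" using W by (simp add: triangular_def Wc_def)
  have ext: "entire_extension Wq V \<longleftrightarrow> V = neumann Wc" for V
    unfolding Wc_def W_def
  proof (rule entire_extension_neumann)
    show "triangular (Wq 0)" using W by (simp only: W_def)
    show "Wq q = neumann (Wq 0) q" if "0 \<le> q" for q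
      using neumann[OF that] by (simp only: W_def)
  qed
  show ?thesis
  proof (intro conjI allI impI)
    fix q :: real and F :: "nat \<Rightarrow> nat \<Rightarrow> real" assume q: "0 \<le> q"
    show "(triangular F \<and> (\<forall>x\<ge>1. \<forall>y. mat_prod Q F x y = id_mat x y + q * F x y)) \<longleftrightarrow> F = Wq q"
      using triangular_solution_unique[OF q, of F "Wq q"] tri[OF q] eq[OF q] by blast
  next
    fix q :: real and x y :: nat assume q: "0 \<le> q"
    show "(\<lambda>n. q ^ n * mat_pow W (n + 1) x y) sums Wq q x y"
      using neumann_sums[OF W, of q x y] by (simp add: neumann[OF q])
    have "{n. int n \<le> int y - int x - 1} \<subseteq> {..<y}" by auto
    then have "finite {n. int n \<le> int y - int x - 1}" by (rule finite_subset) simp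
    moreover have "{n. x + n < y} \<subseteq> {n. int n \<le> int y - int x - 1}" by auto
    ultimately show "Wq q x y = (\<Sum>n | int n \<le> int y - int x - 1. q ^ n * mat_pow W (n + 1) x y)"
      unfolding neumann[OF q] Suc_eq_plus1[symmetric] by (rule neumann_eq_sum[OF W])
  next
    show "\<exists>!V. entire_extension Wq V" by (simp add: ext)
  next
    fix V :: "complex \<Rightarrow> nat \<Rightarrow> nat \<Rightarrow> complex" and x y :: nat assume "entire_extension Wq V"
    then show "\<exists>p. \<forall>q. V q x y = poly p q" by (simp add: ext neumann_poly)
  next
    fix V :: "complex \<Rightarrow> nat \<Rightarrow> nat \<Rightarrow> complex" and q :: complex assume "entire_extension Wq V"
    then have V: "V q = neumann Wc q" by (simp add: ext)
    define A where "A = (\<lambda>x y. id_mat x y - q * Wc x y)"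
    have "upper_mat A" using Wc by (auto simp: A_def upper_mat_def triangular_def id_mat_def)
    note inv = upper_inv_unique[OF this is_upper_inverse_neumann(1)[OF Wc, of q, folded A_def]]
    have "upper_invertible A \<and> V q = mat_prod (upper_inv A) Wc \<and> V q = mat_prod Wc (upper_inv A)"
      using inv(1) by (simp add: inv(2) V is_upper_inverse_neumann(2,3)[OF Wc])
    then show "let Wc = (\<lambda>x y. complex_of_real (W x y)); A = (\<lambda>x y. id_mat x y - q * Wc x y)
        in upper_invertible A \<and> V q = mat_prod (upper_inv A) Wc \<and> V q = mat_prod Wc (upper_inv A)"
      unfolding Let_def A_def Wc_def .
  qed
qed

end
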